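(* Let $F(z,w)=(f(z)-\delta w,z)$ be a transcendental Hénon map, and suppose the family $\{f_n\}_{n\in\mathbb N}$, $f_n(z)=f(nz)/n$, is not quasi-normal on $\mathbb C$. Then $h_{\mathrm{top}}(\mathbb C^2,F)=+\infty$.
   Context: A transcendental Hénon map is $F(z,w)=(f(z)-\delta w,z)$ with $f$ transcendental entire and $\delta\ne0$. A family $\mathcal F$ of holomorphic functions on a domain $\Omega$ is quasi-normal if for every sequence in $\mathcal F$ there exist a finite set $Q\subset\Omega$ and a subsequence converging uniformly on compact subsets of $\Omega\setminus Q$ with respect to the spherical metric (limit $\equiv\infty$ allowed). Topological entropy: for a continuous self-map $g$ of a compact metric space $X$, $h_{\mathrm{top}}(X,g)=\sup_{\varepsilon>0}\limsup_n\frac1n\log K(n,\varepsilon)$, where $K(n,\varepsilon)$ is the maximal cardinality of a set $E$ such that any two distinct points $z,w\in E$ satisfy $d(g^k z,g^k w)>\varepsilon$ for some $0\le k\le n-1$; for a non-compact metric space $Y$, $h_{\mathrm{top}}(Y,g)$ is the supremum of $h_{\mathrm{top}}(X,g|_X)$ over compact $X\subset Y$ with $g(X)\subset X$ ($0$ if none). *)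

theory Defs
  imports "HOL-Analysis.Analysis" "HOL-Computational_Algebra.Polynomial" "HOL-Library.Liminf_Limsup"
begin

definition transcendental_entire :: "(complex \<Rightarrow> complex) \<Rightarrow> bool" where
  "transcendental_entire f \<longleftrightarrow> f holomorphic_on UNIV \<and> \<not> (\<exists>p. \<forall>z. f z = poly p z)"

definition henon :: "(complex \<Rightarrow> complex) \<Rightarrow> complex \<Rightarrow> complex \<times> complex \<Rightarrow> complex \<times> complex" where
  "henon f \<delta> = (\<lambda>(z, w). (f z - \<delta> * w, z))"

text \<open>Riemann sphere as complex option (None = infinity) with the chordal (spherical) metric.\<close>
fun chordal :: "complex option \<Rightarrow> complex option \<Rightarrow> real" where
  "chordal (Some a) (Some b) = 2 * cmod (a - b) / sqrt ((1 + (cmod a)\<^sup>2) * (1 + (cmod b)\<^sup>2))"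
| "chordal (Some a) None = 2 / sqrt (1 + (cmod a)\<^sup>2)"
| "chordal None (Some b) = 2 / sqrt (1 + (cmod b)\<^sup>2)"
| "chordal None None = 0"

definition sph_locally_uniform :: "(nat \<Rightarrow> complex \<Rightarrow> complex) \<Rightarrow> (complex \<Rightarrow> complex option) \<Rightarrow> complex set \<Rightarrow> bool" where
  "sph_locally_uniform g \<phi> U \<longleftrightarrow>
     (\<forall>K. compact K \<and> K \<subseteq> U \<longrightarrow>
        (\<forall>e>0. \<exists>N. \<forall>n\<ge>N. \<forall>z\<in>K. chordal (Some (g n z)) (\<phi> z) < e))"

definition quasi_normal :: "(complex \<Rightarrow> complex) set \<Rightarrow> complex set \<Rightarrow> bool" where
  "quasi_normal \<F> \<Omega> \<longleftrightarrow>
     (\<forall>g :: nat \<Rightarrow> complex \<Rightarrow> complex. (\<forall>n. g n \<in> \<F>) \<longrightarrow>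
        (\<exists>Q r \<phi>. finite Q \<and> Q \<subseteq> \<Omega> \<and> strict_mono r \<and>
            sph_locally_uniform (g \<circ> r) \<phi> (\<Omega> - Q)))"

definition separated :: "('a::metric_space \<Rightarrow> 'a) \<Rightarrow> nat \<Rightarrow> real \<Rightarrow> 'a set \<Rightarrow> bool" where
  "separated g n \<epsilon> E \<longleftrightarrow>
     (\<forall>z\<in>E. \<forall>w\<in>E. z \<noteq> w \<longrightarrow> (\<exists>k<n. dist ((g ^^ k) z) ((g ^^ k) w) > \<epsilon>))"

definition max_sep :: "'a::metric_space set \<Rightarrow> ('a \<Rightarrow> 'a) \<Rightarrow> nat \<Rightarrow> real \<Rightarrow> nat" where
  "max_sep X g n \<epsilon> = Sup {card E | E. finite E \<and> E \<subseteq> X \<and> separated g n \<epsilon> E}"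

definition htop_compact :: "'a::metric_space set \<Rightarrow> ('a \<Rightarrow> 'a) \<Rightarrow> ereal" where
  "htop_compact X g =
     (SUP \<epsilon>\<in>{0<..}. limsup (\<lambda>n. ereal (ln (real (max_sep X g n \<epsilon>)) / real n)))"

definition htop :: "'a::metric_space set \<Rightarrow> ('a \<Rightarrow> 'a) \<Rightarrow> ereal" where
  "htop Y g =
     (if \<exists>X. compact X \<and> X \<subseteq> Y \<and> g ` X \<subseteq> X
      then (SUP X\<in>{X. compact X \<and> X \<subseteq> Y \<and> g ` X \<subseteq> X}. htop_compact X g)
      else 0)"

end

(* Write f_n(z) = f(nz)/n; the map F is conjugate to (z, w) -> (f_n(z) - delta w, z) by a dilation.
   If {f_n} is not quasi-normal then for every N some sequence of the f_n is non-normal at N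
   distinct points z_1, ..., z_N, in the sense that Zalcman rescalings f_n(zeta + rho u) around
   each z_i converge to a nonconstant entire function G_i.  By Picard, G_i omits at most one value,
   so for each l, i and all but at most one j there is a tiny disc near z_i on whose boundary f_n
   stays away from z_j + delta z_l while its centre is mapped close to that value.  The orbit
   equation z_{m+1} = f_n(z_m) - delta z_{m-1} can therefore be solved along every
   itinerary whose successive triples (l, i, j) are admissible; it is solved in one complex
   parameter, with the minimum modulus principle replacing any degree argument.  There are at
   least (N - 1)^m such itineraries of length m, so the entropy is at least ln (N - 1). *)

theory Submission
  imports Defs "HOL-Complex_Analysis.Complex_Analysis"
begin

text \<open>Quasi-normality permits finite exceptional sets, and its failure therefore yields
  arbitrarily many blow-up points: off the points already found there is still no convergent
  subsequence, and earlier blow-ups survive further extraction.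

  The obstacle is that each point depends on two earlier ones. In the orbit equation
  \<open>\<delta> * z_{m-1}\<close> is treated as a perturbation, of size at most
  \<open>cmod \<delta> * r\<close>, of a constant; the margin \<open>1 + 2 * cmod \<delta>\<close>
  in \<open>island\<close> absorbs it. Uniqueness of orbits is never controlled: one orbit per
  itinerary is enough, and distinct itineraries are told apart by the distance between the discs.

  Entropy on a noncompact space is measured on compact forward invariant sets, so orbits must stay
  near the centres for all time. Islands are dilated back to \<open>f\<close> itself, so no entropy
  has to be transported through the conjugacy.\<close>

section \<open>Coding of orbits by islands\<close>

text \<open>If \<open>h\<close> had no zero, \<open>1 / h\<close> would be bounded by
  \<open>1 / M\<close> on the frontier and hence on \<open>V\<close> by the maximum modulus
  principle, which fails at \<open>z0\<close>. \<open>V\<close> may be disconnected, so full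
  preimages of discs can be used without passing to components.\<close>

lemma exists_zero_of_small_value:
  assumes "open V" "bounded V" and hol: "h holomorphic_on V" and cont: "continuous_on (closure V) h"
    and fr: "\<And>z. z \<in> frontier V \<Longrightarrow> M \<le> norm (h z)"
    and z0: "z0 \<in> V" "norm (h z0) < M"
  shows "\<exists>z\<in>V. h z = 0"
proof (rule ccontr)
  assume no_zero: "\<not> (\<exists>z\<in>V. h z = 0)"
  have M: "M > 0" using z0(2) norm_ge_zero[of "h z0"] by linarith
  have nz: "h z \<noteq> 0" if "z \<in> closure V" for z
    using that no_zero fr[of z] M \<open>open V\<close> closure_Un_frontier[of V] by auto
  have "norm (1 / h z0) \<le> 1 / M"
  proof (rule maximum_modulus_frontier[where S=V and f="\<lambda>z. 1 / h z"])
    show "(\<lambda>z. 1 / h z) holomorphic_on interior V"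
      using hol nz closure_subset[of V] \<open>open V\<close>
      by (auto simp: interior_open intro!: holomorphic_intros)
    show "continuous_on (closure V) (\<lambda>z. 1 / h z)"
      using cont nz by (auto intro!: continuous_intros)
    show "norm (1 / h z) \<le> 1 / M" if "z \<in> frontier V" for z
      using fr[OF that] M by (simp add: norm_divide frac_le)
  qed (use assms in auto)
  moreover have "norm (h z0) > 0"
    using nz z0 closure_subset[of V] by auto
  ultimately show False
    using z0(2) M by (simp add: norm_divide field_simps)
qed

text \<open>Later, \<open>a = c' + \<delta> * c''\<close> and \<open>\<delta> * w\<close> is within \<open>cmod \<delta> * r\<close> of \<open>\<delta> * c''\<close>, so on the
  boundary of the small disc \<open>f z - \<delta> * w - c'\<close> still has modulus at least
  \<open>(1 + cmod \<delta>) * r\<close>, and at its centre less than that.\<close>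

definition island :: "(complex \<Rightarrow> complex) \<Rightarrow> complex \<Rightarrow> complex \<Rightarrow> complex \<Rightarrow> real \<Rightarrow> bool" where
  "island f \<delta> c a r \<longleftrightarrow>
     (\<exists>p \<rho>. 0 < \<rho> \<and> cball p \<rho> \<subseteq> ball c (r / 2) \<and>
        (\<forall>z\<in>sphere p \<rho>. (1 + 2 * cmod \<delta>) * r \<le> cmod (f z - a)) \<and> cmod (f p - a) < r)"

lemma fst_henon [simp]: "fst (henon f \<delta> p) = f (fst p) - \<delta> * snd p"
  and snd_henon [simp]: "snd (henon f \<delta> p) = fst p"
  by (simp_all add: henon_def split: prod.split)

lemma holomorphic_on_henon_iterates:
  assumes "f holomorphic_on UNIV"
  shows "(\<lambda>t. fst ((henon f \<delta> ^^ n) (t, w))) holomorphic_on UNIV \<and>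
         (\<lambda>t. snd ((henon f \<delta> ^^ n) (t, w))) holomorphic_on UNIV"
proof (induction n)
  case (Suc n)
  have "(f \<circ> (\<lambda>t. fst ((henon f \<delta> ^^ n) (t, w)))) holomorphic_on UNIV"
    using Suc assms by (intro holomorphic_on_compose_gen[of _ UNIV _ UNIV]) auto
  then show ?case using Suc by (auto simp: o_def intro!: holomorphic_intros)
qed auto

text \<open>The cut-down set is open, so a frontier point lies outside it and violates one of the
  two conditions, while continuity preserves both in the closed sense. This identifies the new
  boundary when parameters are restricted.\<close>

lemma frontier_open_subset_cases:
  fixes V U :: "complex set" and Z :: "complex \<Rightarrow> complex"
  assumes "open V" "open U" "continuous_on UNIV Z" "t \<in> frontier {t \<in> V. Z t \<in> U}"
  shows "t \<in> closure V \<and> Z t \<in> closure U \<and> (t \<in> frontier V \<or> Z t \<in> frontier U)"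
proof -
  have op: "open (V \<inter> Z -` U)"
    using assms by (auto intro!: open_Int open_vimage)
  have eq: "{t \<in> V. Z t \<in> U} = V \<inter> Z -` U" by auto
  have tc: "t \<in> closure (V \<inter> Z -` U)" "t \<notin> V \<inter> Z -` U"
    using assms(4) interior_open[OF op] unfolding eq frontier_def by auto
  then have c: "t \<in> closure V" using closure_mono[of "V \<inter> Z -` U" V] by auto
  have "closure (V \<inter> Z -` U) \<subseteq> Z -` closure U"
    by (rule closure_minimal)
      (use assms closure_subset[of U] in \<open>auto intro!: closed_vimage\<close>)
  then have "Z t \<in> closure U" using tc by auto
  with c tc assms show ?thesis by (auto simp: frontier_def interior_open)
qed

text \<open>The orbit of \<open>(t, x 0)\<close> consists of entire functions of \<open>t\<close>. In the induction step \<open>V\<close> is cut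
  down to the parameters whose current point lies in the island, and then to those whose next point
  lies in the prescribed disc.\<close>

lemma orbit_discs:
  fixes x :: "nat \<Rightarrow> complex"
  assumes f: "f holomorphic_on UNIV" and r: "r > 0"
    and isl: "\<And>m. island f \<delta> (x (Suc m)) (x (Suc (Suc m)) + \<delta> * x m) r"
  defines "P \<equiv> \<lambda>m t. (henon f \<delta> ^^ m) (t, x 0)"
  shows "\<exists>V. open V \<and> bounded V \<and>
     (\<forall>t\<in>V. \<forall>m\<le>n. fst (P m t) \<in> ball (x (Suc m)) r \<and> snd (P m t) \<in> ball (x m) r) \<and>
     (\<forall>t\<in>frontier V. r \<le> cmod (fst (P n t) - x (Suc n))) \<and>
     (\<exists>t\<in>V. fst (P n t) = x (Suc n))"
proof (induction n)
  case 0
  show ?case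
    by (rule exI[of _ "ball (x 1) r"]) (use r in \<open>auto simp: P_def dist_norm norm_minus_commute\<close>)
next
  case (Suc n)
  then obtain V where V: "open V" "bounded V"
    and ball: "\<And>t m. t \<in> V \<Longrightarrow> m \<le> n \<Longrightarrow> fst (P m t) \<in> ball (x (Suc m)) r \<and> snd (P m t) \<in> ball (x m) r"
    and fr: "\<And>t. t \<in> frontier V \<Longrightarrow> r \<le> cmod (fst (P n t) - x (Suc n))"
    and hit: "\<exists>t\<in>V. fst (P n t) = x (Suc n)"
    by blast
  define Z where "Z = (\<lambda>n t. fst (P n t))"
  have holZ: "Z m holomorphic_on A" for m A
    using holomorphic_on_henon_iterates[where \<delta>=\<delta> and n=m and w="x 0", OF f]
    unfolding Z_def P_def by (auto intro: holomorphic_on_subset)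
  have contZ: "continuous_on A (Z m)" for m A
    using holZ by (rule holomorphic_on_imp_continuous_on)
  have next_eq: "Z (Suc n) t = f (Z n t) - \<delta> * snd (P n t)" and "snd (P (Suc n) t) = Z n t" for t
    by (auto simp: Z_def P_def)
  obtain p \<rho> where p: "0 < \<rho>" "cball p \<rho> \<subseteq> ball (x (Suc n)) (r / 2)"
    "\<And>z. z \<in> sphere p \<rho> \<Longrightarrow> (1 + 2 * cmod \<delta>) * r \<le> cmod (f z - (x (Suc (Suc n)) + \<delta> * x n))"
    "cmod (f p - (x (Suc (Suc n)) + \<delta> * x n)) < r"
    using isl[of n] unfolding island_def by blast
  have pc: "dist (x (Suc n)) p < r / 2" using p(1,2) by (auto simp: subset_iff)
  define c where "c = x (Suc (Suc n))"
  have err: "cmod (Z (Suc n) t - c - (f (Z n t) - (c + \<delta> * x n))) \<le> cmod \<delta> * r" if "t \<in> V" for t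
  proof -
    have "Z (Suc n) t - c - (f (Z n t) - (c + \<delta> * x n)) = \<delta> * (x n - snd (P n t))"
      by (simp add: next_eq algebra_simps)
    moreover have "cmod (x n - snd (P n t)) \<le> r"
      using ball[OF that order_refl] by (auto simp: dist_norm)
    ultimately show ?thesis by (simp add: norm_mult mult_left_mono)
  qed
  define V1 where "V1 = {t \<in> V. Z n t \<in> ball p \<rho>}"
  \<comment> \<open>Since \<open>p\<close> is within \<open>r / 2\<close> of
    \<open>x (Suc n)\<close>, the modulus of \<open>Z n - p\<close> is at least \<open>r / 2\<close>
    on the frontier of \<open>V\<close> but smaller at the parameter that hits
    \<open>x (Suc n)\<close>. This is why the induction carries such a parameter and why islands lie
    in discs of half radius.\<close>
  have "\<exists>t\<in>V. Z n t - p = 0"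
  proof -
    obtain t0 where t0: "t0 \<in> V" "Z n t0 = x (Suc n)" using hit by (auto simp: Z_def)
    show ?thesis
    proof (rule exists_zero_of_small_value[where M="r/2"])
      show "r / 2 \<le> cmod (Z n z - p)" if "z \<in> frontier V" for z
      proof -
        have "cmod (Z n z - x (Suc n)) \<le> cmod (Z n z - p) + dist (x (Suc n)) p"
          using norm_triangle_ineq[of "Z n z - p" "p - x (Suc n)"]
          by (simp add: dist_norm norm_minus_commute)
        then show ?thesis using fr[OF that] pc by (simp add: Z_def)
      qed
    qed (use V t0 pc in \<open>auto simp: dist_norm intro!: continuous_intros holomorphic_intros holZ contZ\<close>)
  qed
  then obtain t1 where t1: "t1 \<in> V1" "Z n t1 = p" using p(1) by (auto simp: V1_def)
  have V1: "open V1" "bounded V1" "V1 \<subseteq> V"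
  proof -
    have "V1 = V \<inter> Z n -` ball p \<rho>" by (auto simp: V1_def)
    then show "open V1" using V contZ by (auto intro!: open_Int open_vimage)
    show "bounded V1" using V by (auto intro: bounded_subset simp: V1_def)
  qed (auto simp: V1_def)
  \<comment> \<open>The old frontier drops out: there \<open>Z n t\<close> is at distance at least
    \<open>r\<close> from \<open>x (Suc n)\<close>, whereas the island stays within
    \<open>r / 2\<close>. On the circle around \<open>p\<close>, the error \<open>err\<close> costs
    one \<open>cmod \<delta> * r\<close> of the margin.\<close>
  have fr1: "(1 + cmod \<delta>) * r \<le> cmod (Z (Suc n) t - c)" if "t \<in> frontier V1" for t
  proof -
    have t: "t \<in> closure V" "Z n t \<in> cball p \<rho>" "t \<in> frontier V \<or> Z n t \<in> sphere p \<rho>"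
      using frontier_open_subset_cases[OF V(1) open_ball contZ, of t n p \<rho>] that p(1)
      by (auto simp: V1_def)
    have "t \<notin> frontier V"
    proof
      assume "t \<in> frontier V"
      then have "r \<le> dist (x (Suc n)) (Z n t)" using fr by (auto simp: Z_def dist_norm norm_minus_commute)
      moreover have "dist (x (Suc n)) (Z n t) < r / 2" using t(2) p(2) by (auto simp: subset_iff)
      ultimately show False using r by simp
    qed
    then have tV: "t \<in> V" using t(1) closure_Un_frontier[of V] by auto
    have "(1 + 2 * cmod \<delta>) * r \<le> cmod (f (Z n t) - (c + \<delta> * x n))"
      using t(3) \<open>t \<notin> frontier V\<close> p(3) by (auto simp: c_def)
    also have "\<dots> \<le> cmod (Z (Suc n) t - c) + cmod \<delta> * r"
      using err[OF tV] norm_triangle_ineq2[of "f (Z n t) - (c + \<delta> * x n)" "Z (Suc n) t - c"]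
        norm_minus_commute[of "f (Z n t) - (c + \<delta> * x n)" "Z (Suc n) t - c"] by linarith
    finally show ?thesis by (simp add: algebra_simps)
  qed
  have "cmod (Z (Suc n) t1 - c) < (1 + cmod \<delta>) * r"
  proof -
    have "t1 \<in> V" using t1 V1 by auto
    from err[OF this] p(4) t1(2)
      norm_triangle_ineq2[of "Z (Suc n) t1 - c" "f (Z n t1) - (c + \<delta> * x n)"]
    show ?thesis by (simp add: c_def algebra_simps)
  qed
  then have "\<exists>t\<in>V1. Z (Suc n) t - c = 0"
    using V1 t1 fr1
    by (intro exists_zero_of_small_value[where M="(1 + cmod \<delta>) * r"])
      (auto intro!: continuous_intros holomorphic_intros holZ contZ)
  then obtain t2 where t2: "t2 \<in> V1" "Z (Suc n) t2 = c" by auto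
  define V2 where "V2 = {t \<in> V1. Z (Suc n) t \<in> ball c r}"
  show ?case
  proof (intro exI[of _ V2] conjI ballI allI impI)
    have "V2 = V1 \<inter> Z (Suc n) -` ball c r" by (auto simp: V2_def)
    then show "open V2" using V1 contZ by (auto intro!: open_Int open_vimage)
    show "bounded V2" using V1 by (auto intro: bounded_subset simp: V2_def)
    show "r \<le> cmod (fst (P (Suc n) t) - x (Suc (Suc n)))" if "t \<in> frontier V2" for t
    proof -
      have "t \<in> frontier V1 \<or> Z (Suc n) t \<in> sphere c r"
        using frontier_open_subset_cases[OF V1(1) open_ball contZ, of t "Suc n" c r] that r
        by (auto simp: V2_def)
      then show ?thesis
      proof
        assume "t \<in> frontier V1"
        from fr1[OF this] have "(1 + cmod \<delta>) * r \<le> cmod (Z (Suc n) t - c)" .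
        moreover have "0 \<le> cmod \<delta> * r" using r by simp
        ultimately have "r \<le> cmod (Z (Suc n) t - c)" by (simp add: algebra_simps)
        then show ?thesis by (simp add: Z_def c_def)
      qed (auto simp: Z_def c_def dist_norm norm_minus_commute)
    qed
    show "\<exists>t\<in>V2. fst (P (Suc n) t) = x (Suc (Suc n))"
      using t2 r by (intro bexI[of _ t2]) (auto simp: V2_def Z_def c_def)
    fix t m assume t: "t \<in> V2" and m: "m \<le> Suc n"
    have tV: "t \<in> V" using t V1 by (auto simp: V2_def)
    show "fst (P m t) \<in> ball (x (Suc m)) r"
      using m ball[OF tV, of m] t by (cases "m = Suc n") (auto simp: V2_def Z_def c_def)
    show "snd (P m t) \<in> ball (x m) r"
    proof (cases "m = Suc n")
      case True
      then show ?thesis using ball[OF tV order_refl] by (simp add: P_def)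
    qed (use m ball[OF tV, of m] in auto)
  qed
qed

section \<open>Infinite orbits from nested compact sets\<close>

lemma continuous_on_henon:
  assumes "f holomorphic_on UNIV"
  shows "continuous_on A (henon f \<delta>)"
proof -
  have "continuous_on UNIV f" using assms by (rule holomorphic_on_imp_continuous_on)
  then have "continuous_on A (\<lambda>p. f (fst p))"
    by (auto intro!: continuous_on_compose2[of UNIV f] continuous_intros)
  then have "continuous_on A (\<lambda>p. (f (fst p) - \<delta> * snd p, fst p))"
    by (intro continuous_intros)
  moreover have "henon f \<delta> = (\<lambda>p. (f (fst p) - \<delta> * snd p, fst p))"
    by (auto simp: henon_def)
  ultimately show ?thesis by simp
qed

lemma continuous_on_iterate:
  fixes g :: "'a::topological_space \<Rightarrow> 'a"
  assumes "continuous_on UNIV g"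
  shows "continuous_on A (g ^^ n)"
proof -
  have "continuous_on UNIV (g ^^ n)"
    by (induction n) (auto intro: continuous_on_compose2[OF assms] simp: o_def id_def)
  then show ?thesis by (rule continuous_on_subset) auto
qed

text \<open>The parameter sets of \<open>orbit_discs\<close> for different \<open>n\<close> need not
  be nested. The limit is therefore taken over the starting points that follow the closed discs up
  to time \<open>n\<close>; these form decreasing nonempty compact sets.\<close>

lemma orbit_exists:
  fixes x :: "nat \<Rightarrow> complex"
  assumes f: "f holomorphic_on UNIV" and r: "r > 0"
    and isl: "\<And>m. island f \<delta> (x (Suc m)) (x (Suc (Suc m)) + \<delta> * x m) r"
  shows "\<exists>p. \<forall>m. (henon f \<delta> ^^ m) p \<in> cball (x (Suc m)) r \<times> cball (x m) r"
proof -
  define C where "C = (\<lambda>m. (henon f \<delta> ^^ m) -` (cball (x (Suc m)) r \<times> cball (x m) r))"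
  define A where "A = (\<lambda>n. \<Inter>m\<le>n. C m)"
  have cl: "closed (C m)" for m
    unfolding C_def
    by (intro closed_vimage closed_Times closed_cball continuous_on_iterate continuous_on_henon f)
  have sub: "A n \<subseteq> cball (x 1) r \<times> cball (x 0) r" for n
    unfolding A_def C_def by (rule INF_lower2[of 0]) auto
  have "\<Inter>(range A) \<noteq> {}"
  proof (rule compact_nest)
    show "compact (A n)" for n
    proof -
      have "closed (A n)" unfolding A_def using cl by (intro closed_INT) auto
      moreover have "bounded (A n)"
        using sub by (rule bounded_subset[rotated]) (intro bounded_Times bounded_cball)
      ultimately show ?thesis by (simp add: compact_eq_bounded_closed)
    qed
    show "A n \<noteq> {}" for n
    proof -
      obtain V t where "t \<in> V"
        "\<forall>t\<in>V. \<forall>m\<le>n. fst ((henon f \<delta> ^^ m) (t, x 0)) \<in> ball (x (Suc m)) r \<and>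
           snd ((henon f \<delta> ^^ m) (t, x 0)) \<in> ball (x m) r"
        using orbit_discs[where \<delta>=\<delta> and x=x and n=n, OF f r isl] by blast
      then have "(t, x 0) \<in> A n"
        by (force simp: A_def C_def mem_Times_iff)
      then show ?thesis by auto
    qed
    show "A n \<subseteq> A m" if "m \<le> n" for m n
      using that by (auto simp: A_def)
  qed
  then obtain p where p: "p \<in> A n" for n by blast
  have "(henon f \<delta> ^^ m) p \<in> cball (x (Suc m)) r \<times> cball (x m) r" for m
    using p[of m] unfolding A_def C_def by blast
  then show ?thesis by blast
qed

section \<open>Entropy from separated orbits\<close>

text \<open>\<open>max_sep\<close> is a supremum of natural numbers, informative only once the
  cardinalities are bounded. Finitely many dynamical balls \<open>U x\<close> of radius
  \<open>\<epsilon> / 2\<close> cover \<open>X\<close>, and each holds at most one point of a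
  separated set.\<close>

lemma card_separated_bounded:
  assumes "compact X" "continuous_on UNIV g" "\<epsilon> > 0"
  shows "\<exists>M. \<forall>E. finite E \<and> E \<subseteq> X \<and> separated g n \<epsilon> E \<longrightarrow> card E \<le> M"
proof -
  define U where "U = (\<lambda>x. \<Inter>k<n. (g ^^ k) -` ball ((g ^^ k) x) (\<epsilon> / 2))"
  have "open (U x)" for x
    unfolding U_def using continuous_on_iterate[OF assms(2)] by (auto intro!: open_INT open_vimage)
  moreover have "X \<subseteq> (\<Union>x\<in>X. U x)" using assms(3) by (auto simp: U_def)
  ultimately obtain T where T: "T \<subseteq> X" "finite T" "X \<subseteq> (\<Union>x\<in>T. U x)"
    using assms(1) by (metis compactE_image)
  have "card E \<le> card T" if E: "finite E" "E \<subseteq> X" "separated g n \<epsilon> E" for E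
  proof -
    have "\<forall>y\<in>E. \<exists>x\<in>T. y \<in> U x" using T(3) E(2) by auto
    then obtain \<tau> where \<tau>: "\<And>y. y \<in> E \<Longrightarrow> \<tau> y \<in> T \<and> y \<in> U (\<tau> y)" by metis
    have "inj_on \<tau> E"
    proof (rule inj_onI, rule ccontr)
      fix y z assume yz: "y \<in> E" "z \<in> E" "\<tau> y = \<tau> z" "y \<noteq> z"
      then obtain k where k: "k < n" "dist ((g ^^ k) y) ((g ^^ k) z) > \<epsilon>"
        using E(3) unfolding separated_def by blast
      moreover have "dist ((g ^^ k) (\<tau> y)) ((g ^^ k) y) < \<epsilon> / 2" "dist ((g ^^ k) (\<tau> y)) ((g ^^ k) z) < \<epsilon> / 2"
        using \<tau>[OF yz(1)] \<tau>[OF yz(2)] yz(3) k(1) by (auto simp: U_def)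
      ultimately show False
        using dist_triangle_half_r by (metis less_asym)
    qed
    then show ?thesis using \<tau> T(2) by (auto intro!: card_inj_on_le)
  qed
  then show ?thesis by blast
qed

text \<open>One scale suffices because entropy is a supremum over scales. Having
  \<open>q ^ n\<close> points at time \<open>Suc n\<close> instead of \<open>n\<close> costs only
  the factor \<open>(n - 1) / n\<close>, which tends to 1.\<close>

lemma htop_compact_ge_ln:
  fixes q :: nat
  assumes "compact X" "continuous_on UNIV g" "\<epsilon> > 0" "q > 0"
    and E: "\<And>n. \<exists>E. finite E \<and> E \<subseteq> X \<and> separated g (Suc n) \<epsilon> E \<and> q ^ n \<le> card E"
  shows "ereal (ln (real q)) \<le> htop_compact X g"
proof -
  have ge: "q ^ n \<le> max_sep X g (Suc n) \<epsilon>" for n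
  proof -
    obtain E0 where E0: "finite E0" "E0 \<subseteq> X" "separated g (Suc n) \<epsilon> E0" "q ^ n \<le> card E0"
      using E by blast
    have "card E0 \<le> max_sep X g (Suc n) \<epsilon>"
      unfolding max_sep_def
    proof (rule cSup_upper)
      show "bdd_above {card E |E. finite E \<and> E \<subseteq> X \<and> separated g (Suc n) \<epsilon> E}"
        using card_separated_bounded[OF assms(1-3), of "Suc n"] by (auto simp: bdd_above_def)
    qed (use E0 in auto)
    with E0 show ?thesis by simp
  qed
  define L where "L = (\<lambda>n. ereal (real (n - 1) / real n * ln (real q)))"
  have "(\<lambda>n. real (n - 1) / real n * ln (real q)) \<longlonglongrightarrow> 1 * ln (real q)"
  proof (intro tendsto_mult tendsto_const)
    have "(\<lambda>n. real n / real (Suc n)) \<longlonglongrightarrow> 1" by (rule LIMSEQ_n_over_Suc_n)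
    then show "(\<lambda>n. real (n - 1) / real n) \<longlonglongrightarrow> 1"
      by (subst filterlim_sequentially_Suc[symmetric]) simp
  qed
  then have "L \<longlonglongrightarrow> ereal (ln (real q))"
    unfolding L_def by (intro tendsto_ereal) simp
  then have "ereal (ln (real q)) = limsup L"
    by (simp add: lim_imp_Limsup)
  also have "limsup L \<le> limsup (\<lambda>n. ereal (ln (real (max_sep X g n \<epsilon>)) / real n))"
  proof (rule Limsup_mono)
    show "\<forall>\<^sub>F n in sequentially. L n \<le> ereal (ln (real (max_sep X g n \<epsilon>)) / real n)"
      using eventually_ge_at_top[of 1]
    proof eventually_elim
      case (elim n)
      then obtain m where n: "n = Suc m" by (cases n) auto
      have "real m * ln (real q) = ln (real (q ^ m))"
        using assms(4) by (simp add: ln_realpow)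
      also have "\<dots> \<le> ln (real (max_sep X g n \<epsilon>))"
      proof (subst ln_le_cancel_iff)
        show "0 < real (q ^ m)" using assms(4) by simp
        then show "0 < real (max_sep X g n \<epsilon>)"
          using ge[of m] n by (metis of_nat_le_iff order_less_le_trans)
      qed (use ge[of m] n in \<open>simp only: of_nat_le_iff\<close>)
      finally show ?case using n by (simp add: L_def divide_right_mono)
    qed
  qed
  also have "\<dots> \<le> htop_compact X g"
    unfolding htop_compact_def using assms(3) by (intro SUP_upper) auto
  finally show ?thesis .
qed

text \<open>\<open>\<beta> l i\<close> is to enumerate \<open>q\<close> admissible successors of the
  pair \<open>(l, i)\<close>, among which the digit \<open>d m\<close> chooses. Free digit sequences
  thus parametrise admissible words, so counting is immediate although admissibility involves three
  consecutive letters.\<close>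

fun coded_word :: "(nat \<Rightarrow> nat \<Rightarrow> nat \<Rightarrow> nat) \<Rightarrow> (nat \<Rightarrow> nat) \<Rightarrow> nat \<Rightarrow> nat" where
  "coded_word \<beta> d 0 = 0"
| "coded_word \<beta> d (Suc 0) = 0"
| "coded_word \<beta> d (Suc (Suc m)) = \<beta> (coded_word \<beta> d m) (coded_word \<beta> d (Suc m)) (d m)"

text \<open>If the words agreed up to position \<open>k + 2\<close>, their letters at
  \<open>k\<close> and \<open>k + 1\<close> would select the same injection
  \<open>\<beta> l i\<close>, and it would take one value at the two digits \<open>d k\<close> and
  \<open>e k\<close>.\<close>

lemma coded_word_differ:
  assumes "\<And>l i. l < N \<Longrightarrow> i < N \<Longrightarrow> inj_on (\<beta> l i) D"
    and lt: "\<And>m. coded_word \<beta> d m < N" and "\<And>m. d m \<in> D" "\<And>m. e m \<in> D" and "d k \<noteq> e k"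
  shows "\<exists>m\<le>k. coded_word \<beta> d (m + 2) \<noteq> coded_word \<beta> e (m + 2)"
proof (rule ccontr)
  assume eq: "\<not> ?thesis"
  have "coded_word \<beta> d m = coded_word \<beta> e m" if "m \<le> k + 2" for m
  proof -
    consider "m = 0" | "m = 1" | j where "m = j + 2"
      by (metis One_nat_def add_2_eq_Suc' old.nat.exhaust)
    then show ?thesis using that eq by cases auto
  qed
  from this[of k] this[of "Suc k"] this[of "k + 2"] show False
    using inj_onD[OF assms(1)[OF lt lt], of k "Suc k" "d k" "e k"] assms(3-5) by simp
qed

theorem htop_henon_ge_ln:
  fixes c :: "nat \<Rightarrow> complex"
  assumes f: "f holomorphic_on UNIV" and r: "r > 0" and q: "q > 0" and N: "N > 0"
    and sep: "\<And>i j. i < N \<Longrightarrow> j < N \<Longrightarrow> i \<noteq> j \<Longrightarrow> dist (c i) (c j) > 3 * r"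
    and isl: "\<And>l i. l < N \<Longrightarrow> i < N \<Longrightarrow>
      \<exists>B\<subseteq>{..<N}. card B = q \<and> (\<forall>j\<in>B. island f \<delta> (c i) (c j + \<delta> * c l) r)"
  shows "ereal (ln (real q)) \<le> htop UNIV (henon f \<delta>)"
proof -
  let ?F = "henon f \<delta>"
  have contF: "continuous_on UNIV ?F" using f by (rule continuous_on_henon)
  define K where "K = (\<Union>i<N. cball (c i) r)"
  \<comment> \<open>The points whose whole forward orbit stays in \<open>K \<times> K\<close>:
    forward invariant by construction, and large enough to contain every coded orbit.\<close>
  define X where "X = (\<Inter>m. (?F ^^ m) -` (K \<times> K))"
  have cK: "compact K" unfolding K_def by (intro compact_UN) auto
  have "closed X" unfolding X_def
    by (intro closed_INT ballI closed_vimage closed_Times continuous_on_iterate contF compact_imp_closed cK)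
  moreover have "X \<subseteq> K \<times> K" unfolding X_def by (rule INF_lower2[of 0]) auto
  ultimately have cX: "compact X"
    using compact_Times[OF cK cK] bounded_subset compact_eq_bounded_closed by metis
  have inv: "?F ` X \<subseteq> X"
  proof (intro image_subsetI, unfold X_def, intro INT_I vimageI2)
    fix p m assume "p \<in> (\<Inter>m. (?F ^^ m) -` (K \<times> K))"
    then have "(?F ^^ Suc m) p \<in> K \<times> K" by blast
    then show "(?F ^^ m) (?F p) \<in> K \<times> K" by (simp add: funpow_swap1)
  qed
  have ex_bij: "\<exists>b. bij_betw b {..<q} B" if "B \<subseteq> {..<N}" "card B = q" for B
    using that finite_subset[OF that(1)] ex_bij_betw_nat_finite[of B] by (auto simp: lessThan_atLeast0)
  have "\<exists>b. inj_on b {..<q} \<and> (\<forall>t<q. b t < N \<and> island f \<delta> (c i) (c (b t) + \<delta> * c l) r)"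
    if li: "l < N" "i < N" for l i
  proof -
    obtain B where B: "B \<subseteq> {..<N}" "card B = q" "\<forall>j\<in>B. island f \<delta> (c i) (c j + \<delta> * c l) r"
      using isl[OF li] by blast
    obtain b where "bij_betw b {..<q} B"
      using ex_bij[OF B(1,2)] by blast
    then show ?thesis using B by (intro exI[of _ b]) (auto simp: bij_betw_def)
  qed
  then obtain \<beta> where inj: "\<And>l i. l < N \<Longrightarrow> i < N \<Longrightarrow> inj_on (\<beta> l i) {..<q}"
    and \<beta>: "\<And>l i t. l < N \<Longrightarrow> i < N \<Longrightarrow> t < q \<Longrightarrow>
      \<beta> l i t < N \<and> island f \<delta> (c i) (c (\<beta> l i t) + \<delta> * c l) r"
    by metis
  have lt: "coded_word \<beta> d m < N \<and> coded_word \<beta> d (Suc m) < N" if "\<And>m. d m < q" for d m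
    by (induction m) (use N \<beta> that in auto)
  have orb: "\<exists>p. \<forall>m. (?F ^^ m) p \<in> cball (c (coded_word \<beta> d (Suc m))) r \<times> cball (c (coded_word \<beta> d m)) r"
    if "\<And>m. d m < q" for d
    by (rule orbit_exists[OF f r, where x="\<lambda>m. c (coded_word \<beta> d m)"]) (use lt[OF that] \<beta> that in auto)
  have "ereal (ln (real q)) \<le> htop_compact X ?F"
  proof (rule htop_compact_ge_ln[OF cX contF r q])
    fix n :: nat
    define D :: "(nat \<Rightarrow> nat) set" where "D = PiE {..<n} (\<lambda>_. {..<q})"
    \<comment> \<open>Orbits are coded by infinite sequences, but only the first \<open>n\<close>
      digits are free. The others are 0, a legal digit because \<open>q > 0\<close>.\<close>
    define ext where "ext = (\<lambda>d m. if m < n then d m else (0::nat))"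
    have ext: "ext d m < q" if "d \<in> D" for d m
      using that q by (auto simp: ext_def D_def PiE_def Pi_def)
    have "\<forall>d\<in>D. \<exists>p. \<forall>m. (?F ^^ m) p \<in> cball (c (coded_word \<beta> (ext d) (Suc m))) r \<times> cball (c (coded_word \<beta> (ext d) m)) r"
      using orb ext by blast
    then obtain p where p: "\<And>d m. d \<in> D \<Longrightarrow>
        (?F ^^ m) (p d) \<in> cball (c (coded_word \<beta> (ext d) (Suc m))) r \<times> cball (c (coded_word \<beta> (ext d) m)) r"
      by metis
    have sepD: "\<exists>k<Suc n. dist ((?F ^^ k) (p d)) ((?F ^^ k) (p e)) > r"
      if de: "d \<in> D" "e \<in> D" "d \<noteq> e" for d e
    proof -
      obtain k where k: "k < n" "d k \<noteq> e k"
        using de unfolding D_def by (metis PiE_ext lessThan_iff)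
      have "\<exists>m\<le>k. coded_word \<beta> (ext d) (m + 2) \<noteq> coded_word \<beta> (ext e) (m + 2)"
        by (rule coded_word_differ[where N=N and D="{..<q}"])
          (use inj lt ext de k in \<open>auto simp: ext_def\<close>)
      then obtain m where m: "m \<le> k" "coded_word \<beta> (ext d) (m + 2) \<noteq> coded_word \<beta> (ext e) (m + 2)"
        by blast
      let ?a = "c (coded_word \<beta> (ext d) (m + 2))" and ?b = "c (coded_word \<beta> (ext e) (m + 2))"
      \<comment> \<open>The letter at position \<open>m + 2\<close> is seen in the first coordinate
        at time \<open>Suc m\<close>, which is below \<open>Suc n\<close> as
        \<open>m \<le> k\<close> and \<open>k < n\<close>; hence the extra time step. Orbit points
        are within \<open>r\<close> of their centres, so a gap above \<open>3 * r\<close> leaves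
        more than \<open>r\<close>.\<close>
      have "dist ?a ?b > 3 * r"
        using sep lt[of "ext d" "Suc m"] lt[of "ext e" "Suc m"] ext de m by simp
      moreover have "dist ?a (fst ((?F ^^ Suc m) (p d))) \<le> r" "dist ?b (fst ((?F ^^ Suc m) (p e))) \<le> r"
        using p[OF de(1), of "Suc m"] p[OF de(2), of "Suc m"] by (auto simp: mem_Times_iff)
      ultimately have "dist (fst ((?F ^^ Suc m) (p d))) (fst ((?F ^^ Suc m) (p e))) > r"
        using dist_triangle[of ?a ?b "fst ((?F ^^ Suc m) (p d))"]
          dist_triangle[of "fst ((?F ^^ Suc m) (p d))" ?b "fst ((?F ^^ Suc m) (p e))"]
          dist_commute[of ?b "fst ((?F ^^ Suc m) (p e))"] by linarith
      then have "dist ((?F ^^ Suc m) (p d)) ((?F ^^ Suc m) (p e)) > r"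
        using dist_fst_le order_less_le_trans by blast
      then show ?thesis using m k by (intro exI[of _ "Suc m"]) auto
    qed
    have "inj_on p D"
    proof (rule inj_onI, rule ccontr)
      fix d e assume "d \<in> D" "e \<in> D" "p d = p e" "d \<noteq> e"
      with sepD[of d e] r show False by auto
    qed
    then have "card (p ` D) = q ^ n" by (simp add: card_image D_def card_PiE)
    moreover have "finite D" by (auto simp: D_def intro!: finite_PiE)
    moreover have "p ` D \<subseteq> X"
    proof
      fix y assume "y \<in> p ` D"
      then obtain d where d: "d \<in> D" "y = p d" by auto
      have "(?F ^^ m) y \<in> K \<times> K" for m
      proof -
        have "coded_word \<beta> (ext d) m < N" "coded_word \<beta> (ext d) (Suc m) < N"
          using lt[of "ext d" m] ext d by auto
        then show ?thesis using p[OF d(1), of m] d(2) unfolding K_def by (auto simp: mem_Times_iff)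
      qed
      then show "y \<in> X" by (auto simp: X_def)
    qed
    moreover have "separated ?F (Suc n) r (p ` D)"
      unfolding separated_def using sepD by blast
    ultimately show "\<exists>E. finite E \<and> E \<subseteq> X \<and> separated ?F (Suc n) r E \<and> q ^ n \<le> card E"
      by (intro exI[of _ "p ` D"]) auto
  qed
  also have "\<dots> \<le> htop UNIV ?F"
    unfolding htop_def using cX inv by (auto intro!: SUP_upper)
  finally show ?thesis .
qed

section \<open>Spherical derivatives and normality\<close>

text \<open>Inverse stereographic projection to the unit sphere, with infinity at the pole
  \<open>(0, 1)\<close>. The chordal metric becomes a Euclidean distance, so convergence to infinity
  can be treated in a complete normed space.\<close>

definition stereo :: "complex \<Rightarrow> complex \<times> real" where
  "stereo a = ((2 / (1 + (cmod a)\<^sup>2)) *\<^sub>R a, 1 - 2 / (1 + (cmod a)\<^sup>2))"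

fun stereo_ext :: "complex option \<Rightarrow> complex \<times> real" where
  "stereo_ext (Some a) = stereo a"
| "stereo_ext None = (0, 1)"

lemma one_plus_cmod_power2_pos [simp]: "0 < 1 + (cmod a)\<^sup>2" "1 + (cmod a)\<^sup>2 \<noteq> 0"
  by (auto intro: add_pos_nonneg simp: add_nonneg_eq_0_iff)

lemma norm_stereo_ext [simp]: "norm (stereo_ext p) = 1"
proof (cases p)
  case (Some a)
  define A where "A = 1 + (cmod a)\<^sup>2"
  have A: "A > 0" by (simp add: A_def)
  have "(norm (stereo a))\<^sup>2 = (2 / A)\<^sup>2 * (cmod a)\<^sup>2 + (1 - 2 / A)\<^sup>2"
    unfolding stereo_def A_def[symmetric] norm_Pair norm_scaleR by (simp add: power_mult_distrib power_divide)
  also have "\<dots> = (2 / A)\<^sup>2 * (A - 1) + (1 - 2 / A)\<^sup>2" by (simp add: A_def)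
  also have "\<dots> = 1" using A by (simp add: field_simps power2_eq_square)
  finally have "(norm (stereo a))\<^sup>2 = 1\<^sup>2" by simp
  then have "norm (stereo a) = 1" by (subst (asm) power2_eq_iff_nonneg) auto
  then show ?thesis using Some by simp
qed (simp add: norm_Pair)

lemma norm_stereo [simp]: "norm (stereo a) = 1"
  using norm_stereo_ext[of "Some a"] by simp

lemma dist_stereo_ext: "dist (stereo_ext p) (stereo_ext q) = chordal p q"
proof (rule power2_eq_imp_eq)
  have sq: "(dist u v)\<^sup>2 = 2 - 2 * (u \<bullet> v)" if "norm u = 1" "norm v = 1" for u v :: "complex \<times> real"
    using that by (simp add: dist_norm power2_norm_eq_inner inner_diff norm_eq_1 inner_commute)
  show "(dist (stereo_ext p) (stereo_ext q))\<^sup>2 = (chordal p q)\<^sup>2"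
  proof (cases p; cases q)
    fix a b assume pq: "p = Some a" "q = Some b"
    define A B where "A = (cmod a)\<^sup>2" and "B = (cmod b)\<^sup>2"
    have pos: "1 + A > 0" "1 + B > 0" by (auto simp: A_def B_def)
    have "(cmod (a - b))\<^sup>2 = A + B - 2 * (a \<bullet> b)"
      unfolding A_def B_def by (simp add: power2_norm_eq_inner inner_diff inner_commute)
    moreover have "stereo a \<bullet> stereo b = 4 * (a \<bullet> b) / ((1 + A) * (1 + B)) + (1 - 2 / (1 + A)) * (1 - 2 / (1 + B))"
      by (simp add: stereo_def A_def B_def inner_prod_def)
    moreover have "2 - 2 * (4 * d / ((1 + A) * (1 + B)) + (1 - 2 / (1 + A)) * (1 - 2 / (1 + B))) =
       4 * (A + B - 2 * d) / ((1 + A) * (1 + B))" for d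
      using pos by (simp add: divide_simps) (simp add: algebra_simps)
    ultimately show ?thesis
      using sq[of "stereo_ext p" "stereo_ext q"] pq pos
      by (simp add: power_divide power_mult_distrib A_def[symmetric] B_def[symmetric])
  next
    fix a assume pq: "p = Some a" "q = None"
    have "stereo a \<bullet> (0, 1) = 1 - 2 / (1 + (cmod a)\<^sup>2)" by (simp add: inner_prod_def stereo_def)
    then show ?thesis using sq[OF norm_stereo[of a] norm_stereo_ext[of None]] pq
      by (simp add: power_divide)
  next
    fix b assume pq: "p = None" "q = Some b"
    have "stereo b \<bullet> (0, 1) = 1 - 2 / (1 + (cmod b)\<^sup>2)" by (simp add: inner_prod_def stereo_def)
    then show ?thesis using sq[OF norm_stereo[of b] norm_stereo_ext[of None]] pq
      by (simp add: power_divide dist_commute)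
  qed auto
  show "0 \<le> chordal p q" by (cases p; cases q) auto
qed auto

text \<open>Needed to read a limit of projected values back as a point of the Riemann sphere; off
  the pole the preimage is \<open>w / (1 - t)\<close>.\<close>

lemma stereo_ext_surj:
  assumes "norm v = 1"
  shows "\<exists>p. stereo_ext p = v"
proof -
  obtain w t where v: "v = (w, t)" by (cases v)
  have wt: "(cmod w)\<^sup>2 = (1 - t) * (1 + t)"
    using assms by (simp add: v norm_Pair algebra_simps power2_eq_square)
  show ?thesis
  proof (cases "t = 1")
    case True
    then have "w = 0" using wt by simp
    then show ?thesis using True v by (intro exI[of _ None]) simp
  next
    case False
    define a where "a = (1 / (1 - t)) *\<^sub>R w"
    have "1 + (cmod a)\<^sup>2 = 1 + (1 - t) * (1 + t) / (1 - t)\<^sup>2"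
      using wt by (simp add: a_def power_divide power_mult_distrib)
    also have "\<dots> = 2 / (1 - t)" using False by (simp add: divide_simps power2_eq_square)
    finally have eq: "1 + (cmod a)\<^sup>2 = 2 / (1 - t)" .
    then have "stereo_ext (Some a) = v"
      using False unfolding stereo_ext.simps stereo_def eq v by (simp add: a_def field_simps)
    then show ?thesis by blast
  qed
qed

lemma has_derivative_stereo:
  "(stereo has_derivative (\<lambda>v. ((2 / (1 + (cmod a)\<^sup>2)) *\<^sub>R v - (4 * (a \<bullet> v) / (1 + (cmod a)\<^sup>2)\<^sup>2) *\<^sub>R a,
      4 * (a \<bullet> v) / (1 + (cmod a)\<^sup>2)\<^sup>2))) (at a)"
proof -
  have nz: "1 + a \<bullet> a \<noteq> 0" using one_plus_cmod_power2_pos[of a] by (simp add: power2_norm_eq_inner)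
  have D: "((\<lambda>a. 2 / (1 + a \<bullet> a)) has_derivative (\<lambda>v. - (4 * (a \<bullet> v) / (1 + a \<bullet> a)\<^sup>2))) (at a)"
    using nz by (auto intro!: derivative_eq_intros simp: fun_eq_iff power2_eq_square inner_commute divide_simps)
  have "stereo = (\<lambda>a. ((2 / (1 + a \<bullet> a)) *\<^sub>R a, 1 - 2 / (1 + a \<bullet> a)))"
    by (auto simp: fun_eq_iff stereo_def power2_norm_eq_inner)
  moreover have "((\<lambda>a. ((2 / (1 + a \<bullet> a)) *\<^sub>R a, 1 - 2 / (1 + a \<bullet> a))) has_derivative
     (\<lambda>v. ((2 / (1 + a \<bullet> a)) *\<^sub>R v - (4 * (a \<bullet> v) / (1 + a \<bullet> a)\<^sup>2) *\<^sub>R a, 4 * (a \<bullet> v) / (1 + a \<bullet> a)\<^sup>2))) (at a)"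
    by (rule has_derivative_eq_rhs, rule has_derivative_Pair, rule has_derivative_scaleR[OF D has_derivative_ident],
        rule has_derivative_diff[OF has_derivative_const D]) (simp add: fun_eq_iff)
  ultimately show ?thesis by (simp add: power2_norm_eq_inner)
qed

section \<open>Spherical derivative and Marty's criterion\<close>

definition sph_deriv :: "(complex \<Rightarrow> complex) \<Rightarrow> complex \<Rightarrow> real" where
  "sph_deriv g z = cmod (deriv g z) / (1 + (cmod (g z))\<^sup>2)"

lemma sph_deriv_nonneg [simp]: "0 \<le> sph_deriv g z"
  by (simp add: sph_deriv_def add_nonneg_nonneg)

text \<open>Up to the constant this is the conformal factor of the projection. The value 10 is the
  crude sum 2 + 4 + 4 of the bounds for the three terms.\<close>

lemma norm_derivative_stereo_le:
  "norm ((2 / (1 + (cmod a)\<^sup>2)) *\<^sub>R v - (4 * (a \<bullet> v) / (1 + (cmod a)\<^sup>2)\<^sup>2) *\<^sub>R a,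
      4 * (a \<bullet> v) / (1 + (cmod a)\<^sup>2)\<^sup>2) \<le> 10 * (cmod v / (1 + (cmod a)\<^sup>2))"
proof -
  define A where "A = 1 + (cmod a)\<^sup>2"
  have A: "A > 0" "1 \<le> A" by (auto simp: A_def)
  have aA: "cmod a \<le> A"
  proof (cases "cmod a \<le> 1")
    case False
    then have "cmod a * 1 \<le> cmod a * cmod a" by (intro mult_left_mono) auto
    then show ?thesis by (simp add: A_def power2_eq_square)
  qed (use A in auto)
  have ip: "\<bar>a \<bullet> v\<bar> \<le> cmod a * cmod v" by (rule Cauchy_Schwarz_ineq2)
  have 1: "\<bar>4 * (a \<bullet> v) / A\<^sup>2\<bar> \<le> 4 * (cmod v / A)"
  proof -
    have "\<bar>a \<bullet> v\<bar> \<le> A * cmod v" using ip aA mult_right_mono[OF aA norm_ge_zero[of v]] by linarith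
    then have "\<bar>a \<bullet> v\<bar> / A\<^sup>2 \<le> (A * cmod v) / A\<^sup>2" by (rule divide_right_mono) auto
    also have "\<dots> = cmod v / A" using A by (simp add: power2_eq_square)
    finally show ?thesis by (simp add: abs_mult)
  qed
  have 2: "\<bar>4 * (a \<bullet> v) / A\<^sup>2\<bar> * cmod a \<le> 4 * (cmod v / A)"
  proof -
    have "\<bar>a \<bullet> v\<bar> * cmod a \<le> (cmod a * cmod v) * cmod a" using ip by (rule mult_right_mono) auto
    also have "\<dots> \<le> A * cmod v" by (simp add: A_def power2_eq_square algebra_simps)
    finally have "\<bar>a \<bullet> v\<bar> * cmod a / A\<^sup>2 \<le> (A * cmod v) / A\<^sup>2" by (rule divide_right_mono) auto
    also have "\<dots> = cmod v / A" using A by (simp add: power2_eq_square)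
    finally show ?thesis by (simp add: abs_mult)
  qed
  have "norm ((2 / A) *\<^sub>R v - (4 * (a \<bullet> v) / A\<^sup>2) *\<^sub>R a) \<le> 2 * (cmod v / A) + \<bar>4 * (a \<bullet> v) / A\<^sup>2\<bar> * cmod a"
    using norm_triangle_ineq4[of "(2 / A) *\<^sub>R v" "(4 * (a \<bullet> v) / A\<^sup>2) *\<^sub>R a"] A by simp
  with 1 2 show ?thesis
    using norm_Pair_le[of "(2 / A) *\<^sub>R v - (4 * (a \<bullet> v) / A\<^sup>2) *\<^sub>R a" "4 * (a \<bullet> v) / A\<^sup>2"]
    unfolding A_def[symmetric] by simp
qed

text \<open>The mean value inequality for \<open>stereo \<circ> g\<close>; the bound stays uniform
  where \<open>g\<close> itself is large.\<close>

lemma stereo_lipschitz: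
  assumes S: "open S" "convex S" and hol: "g holomorphic_on S"
    and M: "\<And>z. z \<in> S \<Longrightarrow> sph_deriv g z \<le> M" and xy: "x \<in> S" "y \<in> S"
  shows "dist (stereo (g x)) (stereo (g y)) \<le> 10 * M * dist x y"
proof -
  let ?D = "\<lambda>a v. ((2 / (1 + (cmod a)\<^sup>2)) *\<^sub>R v - (4 * (a \<bullet> v) / (1 + (cmod a)\<^sup>2)\<^sup>2) *\<^sub>R a,
      4 * (a \<bullet> v) / (1 + (cmod a)\<^sup>2)\<^sup>2)"
  have "norm ((stereo \<circ> g) x - (stereo \<circ> g) y) \<le> 10 * M * norm (x - y)"
  proof (rule differentiable_bound[OF S(2), where f' = "\<lambda>z. ?D (g z) \<circ> (\<lambda>h. deriv g z * h)"])
    fix z assume z: "z \<in> S"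
    have "(g has_field_derivative deriv g z) (at z)"
      using holomorphic_derivI[OF hol S(1) z] .
    then have "(g has_derivative (\<lambda>h. deriv g z * h)) (at z)"
      by (simp add: has_field_derivative_def)
    then show "(stereo \<circ> g has_derivative ?D (g z) \<circ> (\<lambda>h. deriv g z * h)) (at z within S)"
      by (rule has_derivative_at_withinI[OF diff_chain_at[OF _ has_derivative_stereo]])
    show "onorm (?D (g z) \<circ> (\<lambda>h. deriv g z * h)) \<le> 10 * M"
    proof (rule onorm_bound)
      show "0 \<le> 10 * M" using M[OF z] sph_deriv_nonneg[of g z] by linarith
      fix h
      have "norm (?D (g z) (deriv g z * h)) \<le> 10 * (cmod (deriv g z * h) / (1 + (cmod (g z))\<^sup>2))"
        by (rule norm_derivative_stereo_le)
      also have "\<dots> = 10 * sph_deriv g z * norm h"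
        by (simp add: norm_mult sph_deriv_def)
      also have "\<dots> \<le> 10 * M * norm h" using M[OF z] by (intro mult_right_mono) auto
      finally show "norm ((?D (g z) \<circ> (\<lambda>h. deriv g z * h)) h) \<le> 10 * M * norm h" by (simp only: o_apply)
    qed
  qed (use xy in auto)
  then show ?thesis by (simp add: dist_norm)
qed

text \<open>The half of Arzela-Ascoli that follows a diagonal extraction: Lipschitz bounds uniform
  in late \<open>k\<close> spread the Cauchy property from a dense set to a neighbourhood of each
  point, and compactness does the rest.\<close>

lemma pointwise_convergence_uniformly_Cauchy:
  fixes H :: "nat \<Rightarrow> 'a::metric_space \<Rightarrow> 'b::metric_space"
  assumes lip: "\<And>p. p \<in> \<Omega> \<Longrightarrow> \<exists>r>0. \<exists>L\<ge>0. \<exists>N. \<forall>k\<ge>N. \<forall>x\<in>ball p r. \<forall>y\<in>ball p r. dist (H k x) (H k y) \<le> L * dist x y"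
    and dense: "\<And>U. open U \<Longrightarrow> U \<noteq> {} \<Longrightarrow> \<exists>d\<in>D. d \<in> U"
    and conv: "\<And>d. d \<in> D \<Longrightarrow> Cauchy (\<lambda>k. H k d)"
    and K: "compact K" "K \<subseteq> \<Omega>" and e: "e > 0"
  shows "\<exists>N. \<forall>m\<ge>N. \<forall>n\<ge>N. \<forall>x\<in>K. dist (H m x) (H n x) < e"
proof -
  have "\<exists>\<rho>>0. \<exists>N. \<forall>m\<ge>N. \<forall>n\<ge>N. \<forall>x\<in>ball p \<rho>. dist (H m x) (H n x) < e" if p: "p \<in> K" for p
  proof -
    have "p \<in> \<Omega>" using p K by auto
    then obtain r L and N :: nat where r: "r > 0" "L \<ge> 0"
      "\<And>k x y. k \<ge> N \<Longrightarrow> x \<in> ball p r \<Longrightarrow> y \<in> ball p r \<Longrightarrow> dist (H k x) (H k y) \<le> L * dist x y"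
      using lip[of p] by metis
    \<comment> \<open>Moving from \<open>x\<close> to the dense point \<open>d\<close>, at distance
      at most \<open>2 * \<rho>\<close>, must cost at most \<open>e / 3\<close>;
      \<open>L + 1\<close> guards against \<open>L = 0\<close>.\<close>
    define \<rho> where "\<rho> = min r (e / (6 * (L + 1)))"
    have \<rho>: "\<rho> > 0" using r e by (auto simp: \<rho>_def)
    have L\<rho>: "L * (2 * \<rho>) \<le> e / 3"
    proof -
      have "L * (2 * \<rho>) \<le> (L + 1) * (2 * (e / (6 * (L + 1))))"
        using r \<rho> by (intro mult_mono) (auto simp: \<rho>_def)
      also have "\<dots> = e / 3" using r by (simp add: field_simps)
      finally show ?thesis .
    qed
    obtain d where d: "d \<in> D" "d \<in> ball p \<rho>" using dense[of "ball p \<rho>"] \<rho> by auto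
    obtain N' where N': "\<And>m n. m \<ge> N' \<Longrightarrow> n \<ge> N' \<Longrightarrow> dist (H m d) (H n d) < e / 3"
      using conv[OF d(1)] e unfolding Cauchy_def by (meson divide_pos_pos zero_less_numeral)
    have "dist (H m x) (H n x) < e" if "m \<ge> max N N'" "n \<ge> max N N'" "x \<in> ball p \<rho>" for m n x
    proof -
      have xd: "dist x d \<le> 2 * \<rho>" using that d dist_triangle3[of x d p] by auto
      have "dist (H k x) (H k d) \<le> e / 3" if "k \<ge> N" for k
      proof -
        have "dist (H k x) (H k d) \<le> L * dist x d"
          using r(3)[of k x d] that \<open>x \<in> ball p \<rho>\<close> d by (auto simp: \<rho>_def)
        also have "\<dots> \<le> L * (2 * \<rho>)" using xd r by (intro mult_left_mono) auto
        finally show ?thesis using L\<rho> by simp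
      qed
      from this[of m] this[of n] N'[of m n] that
        dist_triangle[of "H m x" "H n x" "H m d"] dist_triangle[of "H m d" "H n x" "H n d"]
      show ?thesis by (simp add: dist_commute)
    qed
    with \<rho> show ?thesis by blast
  qed
  then obtain \<rho> N where \<rho>: "\<And>p. p \<in> K \<Longrightarrow> \<rho> p > 0"
    and N: "\<And>p m n x. p \<in> K \<Longrightarrow> m \<ge> N p \<Longrightarrow> n \<ge> N p \<Longrightarrow> x \<in> ball p (\<rho> p) \<Longrightarrow> dist (H m x) (H n x) < e"
    by metis
  obtain T where T: "T \<subseteq> K" "finite T" "K \<subseteq> (\<Union>p\<in>T. ball p (\<rho> p))"
    using compactE_image[OF K(1), of K "\<lambda>p. ball p (\<rho> p)"] \<rho> by (metis (no_types, lifting) UN_I centre_in_ball open_ball subsetI)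
  have "dist (H m x) (H n x) < e" if "m \<ge> Max (N ` T)" "n \<ge> Max (N ` T)" "x \<in> K" for m n x
  proof -
    obtain p where p: "p \<in> T" "x \<in> ball p (\<rho> p)" using T(3) \<open>x \<in> K\<close> by auto
    then have "N p \<le> Max (N ` T)" using T by auto
    with that have "N p \<le> m" "N p \<le> n" by simp_all
    moreover have "p \<in> K" using p(1) T(1) by auto
    ultimately show ?thesis using p(2) by (intro N[of p])
  qed
  then show ?thesis by (intro exI[of _ "Max (N ` T)"]) simp
qed

text \<open>The sufficient half of Marty's theorem. Projected functions have norm 1, so a diagonal
  argument gives convergence on a countable dense set, and bounded spherical derivatives make them
  locally equi-Lipschitz.\<close>

lemma marty_convergent_subsequence:
  fixes g :: "nat \<Rightarrow> complex \<Rightarrow> complex"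
  assumes hol: "\<And>k. g k holomorphic_on UNIV"
    and bd: "\<And>p. p \<in> \<Omega> \<Longrightarrow> \<exists>r>0. \<exists>M N. \<forall>k\<ge>N. \<forall>z\<in>ball p r. sph_deriv (g k) z \<le> M"
  shows "\<exists>s \<phi>. strict_mono (s :: nat \<Rightarrow> nat) \<and> sph_locally_uniform (g \<circ> s) \<phi> \<Omega>"
proof -
  have "\<exists>D::complex set. countable D \<and> (\<forall>U. open U \<longrightarrow> U \<noteq> {} \<longrightarrow> (\<exists>d\<in>D. d \<in> U))"
    by (rule countable_dense_exists)
  then obtain D :: "complex set" where D: "countable D" "\<And>U. open U \<Longrightarrow> U \<noteq> {} \<Longrightarrow> \<exists>d\<in>D. d \<in> U"
    by (elim exE conjE) (rule that, assumption, blast)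
  define F where "F = (\<lambda>k z. stereo (g k z))"
  have bounded: "norm (F n z) \<le> 1" for n z by (simp add: F_def)
  obtain s :: "nat \<Rightarrow> nat" where s: "strict_mono s"
    "\<And>d. d \<in> D \<Longrightarrow> \<exists>l. (\<lambda>n. F (s n) d) \<longlonglongrightarrow> l"
    by (rule function_convergent_subsequence[of D F 1, OF D(1) bounded]) (rule that, assumption, assumption)
  define H where "H = (\<lambda>k z. F (s k) z)"
  have cauchy: "\<exists>N. \<forall>m\<ge>N. \<forall>n\<ge>N. \<forall>x\<in>K. dist (H m x) (H n x) < e"
    if K: "compact K" "K \<subseteq> \<Omega>" and e: "e > 0" for K e
  proof (rule pointwise_convergence_uniformly_Cauchy[OF _ D(2) _ K e])
    show "Cauchy (\<lambda>k. H k d)" if "d \<in> D" for d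
      using s(2)[OF that] unfolding H_def by (auto intro: LIMSEQ_imp_Cauchy)
    fix p assume "p \<in> \<Omega>"
    then obtain r M N where r: "r > 0" and M: "\<And>k z. k \<ge> N \<Longrightarrow> z \<in> ball p r \<Longrightarrow> sph_deriv (g k) z \<le> M"
      using bd by meson
    have M0: "M \<ge> 0" using M[of N p] r order_trans[OF sph_deriv_nonneg[of "g N" p]] by auto
    have "dist (H k x) (H k y) \<le> 10 * M * dist x y" if "k \<ge> N" "x \<in> ball p r" "y \<in> ball p r" for k x y
    proof -
      have "s k \<ge> N" using that seq_suble[OF s(1), of k] by linarith
      then show ?thesis
        unfolding H_def F_def using that M hol
        by (intro stereo_lipschitz[where S="ball p r"]) (auto intro: holomorphic_on_subset)
    qed
    then show "\<exists>r>0. \<exists>L\<ge>0. \<exists>N. \<forall>k\<ge>N. \<forall>x\<in>ball p r. \<forall>y\<in>ball p r. dist (H k x) (H k y) \<le> L * dist x y"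
      using r M0 by (intro exI[of _ r] conjI exI[of _ "10 * M"] exI[of _ N]) auto
  qed
  define \<psi> where "\<psi> = (\<lambda>z. lim (\<lambda>k. H k z))"
  have lim: "(\<lambda>k. H k z) \<longlonglongrightarrow> \<psi> z" if "z \<in> \<Omega>" for z
  proof -
    have "Cauchy (\<lambda>k. H k z)"
      using cauchy[of "{z}"] that unfolding Cauchy_def by simp
    then show ?thesis unfolding \<psi>_def by (simp add: Cauchy_convergent_iff convergent_LIMSEQ_iff)
  qed
  have "norm (\<psi> z) = 1" if "z \<in> \<Omega>" for z
  proof -
    have "(\<lambda>k. norm (H k z)) \<longlonglongrightarrow> norm (\<psi> z)" using lim[OF that] by (rule tendsto_norm)
    then show ?thesis by (simp add: H_def F_def LIMSEQ_const_iff)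
  qed
  then have "\<forall>z\<in>\<Omega>. \<exists>p. stereo_ext p = \<psi> z" using stereo_ext_surj by blast
  then obtain \<phi> where \<phi>: "\<And>z. z \<in> \<Omega> \<Longrightarrow> stereo_ext (\<phi> z) = \<psi> z" by metis
  have "sph_locally_uniform (g \<circ> s) \<phi> \<Omega>"
    unfolding sph_locally_uniform_def
  proof (intro allI impI, elim conjE)
    fix K and e :: real assume K: "compact K" "K \<subseteq> \<Omega>" and e: "e > 0"
    obtain N where N: "\<And>m n x. m \<ge> N \<Longrightarrow> n \<ge> N \<Longrightarrow> x \<in> K \<Longrightarrow> dist (H m x) (H n x) < e / 2"
      using cauchy[OF K, of "e / 2"] e by auto
    have "chordal (Some (g (s n) z)) (\<phi> z) < e" if "n \<ge> N" "z \<in> K" for n z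
    proof -
      have z: "z \<in> \<Omega>" using that K by auto
      have "(\<lambda>m. dist (H n z) (H m z)) \<longlonglongrightarrow> dist (H n z) (\<psi> z)"
        using lim[OF z] by (intro tendsto_intros)
      then have "dist (H n z) (\<psi> z) \<le> e / 2"
      proof (rule LIMSEQ_le_const2)
        have "dist (H n z) (H m z) \<le> e / 2" if "m \<ge> N" for m
          using N[OF \<open>n \<ge> N\<close> that \<open>z \<in> K\<close>] by simp
        then show "\<exists>N. \<forall>m\<ge>N. dist (H n z) (H m z) \<le> e / 2" by blast
      qed
      then show ?thesis
        using e unfolding dist_stereo_ext[symmetric] by (simp add: \<phi>[OF z] H_def F_def)
    qed
    then show "\<exists>N. \<forall>n\<ge>N. \<forall>z\<in>K. chordal (Some ((g \<circ> s) n z)) (\<phi> z) < e"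
      unfolding o_apply by blast
  qed
  with s show ?thesis by blast
qed

section \<open>Zalcman's rescaling\<close>

text \<open>The conclusion of Zalcman's lemma at \<open>p\<close>, with an entire limit. As
  \<open>\<rho>\<close> tends to 0, the sets where \<open>g k\<close> imitates \<open>G\<close> on a
  fixed disc shrink to \<open>p\<close>.\<close>

definition blowup :: "(nat \<Rightarrow> complex \<Rightarrow> complex) \<Rightarrow> complex \<Rightarrow> bool" where
  "blowup g p \<longleftrightarrow> (\<exists>\<zeta> \<rho> G. \<zeta> \<longlonglongrightarrow> p \<and> \<rho> \<longlonglongrightarrow> 0 \<and> (\<forall>k. 0 < \<rho> k) \<and>
     G holomorphic_on UNIV \<and> \<not> G constant_on UNIV \<and>
     (\<forall>K. compact K \<longrightarrow> uniform_limit K (\<lambda>k u. g k (\<zeta> k + of_real (\<rho> k) * u)) G sequentially))"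

lemma blowup_subseq:
  assumes "blowup g p" "strict_mono s"
  shows "blowup (g \<circ> s) p"
proof -
  obtain \<zeta> \<rho> G where *: "\<zeta> \<longlonglongrightarrow> p" "\<rho> \<longlonglongrightarrow> 0" "\<And>k. 0 < \<rho> k" "G holomorphic_on UNIV" "\<not> G constant_on UNIV"
    "\<And>K. compact K \<Longrightarrow> uniform_limit K (\<lambda>k u. g k (\<zeta> k + of_real (\<rho> k) * u)) G sequentially"
    using assms(1) unfolding blowup_def by blast
  have s: "filterlim s sequentially sequentially"
    using assms(2) by (rule filterlim_subseq)
  have "uniform_limit K (\<lambda>k u. g (s k) (\<zeta> (s k) + of_real (\<rho> (s k)) * u)) G sequentially"
    if "compact K" for K
    using filterlim_compose[OF *(6)[OF that] s] by simp
  then show ?thesis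
    unfolding blowup_def
    using * LIMSEQ_subseq_LIMSEQ[OF *(1) assms(2)] LIMSEQ_subseq_LIMSEQ[OF *(2) assms(2)]
    by (intro exI[of _ "\<zeta> \<circ> s"] exI[of _ "\<rho> \<circ> s"] exI[of _ G]) auto
qed

text \<open>The two charts of the sphere in projected coordinates: the finite one is continuous away
  from \<open>(0, 1)\<close>, the reciprocal one away from \<open>(0, -1)\<close>. Uniform
  convergence of projections thus passes to functions or to their reciprocals.\<close>

lemma stereo_inverse:
  "fst (stereo a) / of_real (1 - snd (stereo a)) = a"
  "a \<noteq> 0 \<Longrightarrow> cnj (fst (stereo a)) / of_real (1 + snd (stereo a)) = 1 / a"
proof -
  define A where "A = 1 + (cmod a)\<^sup>2"
  have A: "A \<noteq> 0" unfolding A_def by simp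
  then show "fst (stereo a) / of_real (1 - snd (stereo a)) = a"
    by (simp add: stereo_def A_def[symmetric] scaleR_conv_of_real)
  assume a: "a \<noteq> 0"
  have "1 + snd (stereo a) = 2 * (cmod a)\<^sup>2 / A"
    using A by (simp add: stereo_def A_def[symmetric] field_simps) (simp add: A_def)
  then have "cnj (fst (stereo a)) / of_real (1 + snd (stereo a)) = cnj a / of_real ((cmod a)\<^sup>2)"
    using A by (simp add: stereo_def A_def[symmetric] scaleR_conv_of_real)
  also have "\<dots> = 1 / a" using a unfolding complex_norm_square by simp
  finally show "cnj (fst (stereo a)) / of_real (1 + snd (stereo a)) = 1 / a" .
qed

section \<open>Spherical limits of entire functions\<close>

lemma deriv_close:
  assumes "f holomorphic_on ball z r" "continuous_on (cball z r) f"
    "g holomorphic_on ball z r" "continuous_on (cball z r) g" "r > 0"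
    "\<And>w. w \<in> cball z r \<Longrightarrow> dist (f w) (g w) < e"
  shows "dist (deriv f z) (deriv g z) \<le> e / r"
proof -
  have "cmod ((deriv ^^ 1) (\<lambda>w. f w - g w) z) \<le> fact 1 * e / r ^ 1"
    by (rule Cauchy_inequality)
      (use assms in \<open>auto intro!: holomorphic_intros continuous_intros less_imp_le simp: dist_norm norm_minus_commute\<close>)
  moreover have "deriv (\<lambda>w. f w - g w) z = deriv f z - deriv g z"
    using assms by (intro deriv_diff) (auto intro: holomorphic_on_imp_differentiable_at)
  ultimately show ?thesis by (simp add: dist_norm)
qed

text \<open>The set \<open>S\<close> where the limit is \<open>\<infinity>\<close> is open by Hurwitz's theorem applied to \<open>1 / h k\<close>, and
  \<open>S = UNIV\<close> would force the spherical derivatives at \<open>0\<close> to tend to \<open>0\<close>.\<close>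

lemma entire_limit_of_spherical_limit:
  assumes hol: "\<And>k. h k holomorphic_on UNIV" and conv: "sph_locally_uniform h \<phi> UNIV"
    and d0: "\<And>k. sph_deriv (h k) 0 = 1"
  shows "\<exists>G. G holomorphic_on UNIV \<and> \<not> G constant_on UNIV \<and>
    (\<forall>K. compact K \<longrightarrow> uniform_limit K h G sequentially)"
proof -
  define \<psi> where "\<psi> = (\<lambda>z. stereo_ext (\<phi> z))"
  have conth: "continuous_on A (h k)" for A k
    by (intro holomorphic_on_imp_continuous_on holomorphic_on_subset[OF hol]) simp
  have ul: "uniform_limit K (\<lambda>k z. stereo (h k z)) \<psi> sequentially" if "compact K" for K
    unfolding uniform_limit_sequentially_iff
  proof (intro allI impI)
    fix e :: real assume "e > 0"
    then show "\<exists>N. \<forall>n\<ge>N. \<forall>x\<in>K. dist (stereo (h n x)) (\<psi> x) < e"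
      using conv[unfolded sph_locally_uniform_def] that
      by (auto simp: \<psi>_def dist_stereo_ext[symmetric])
  qed
  have cont_stereo: "continuous_on A stereo" for A
    by (intro continuous_at_imp_continuous_on ballI has_derivative_continuous[OF has_derivative_stereo])
  have cont\<psi>_cball: "continuous_on (cball z r) \<psi>" for z r
  proof (rule uniform_limit_theorem[OF _ ul])
    show "\<forall>\<^sub>F n in sequentially. continuous_on (cball z r) (\<lambda>z. stereo (h n z))"
      using conth by (intro always_eventually allI continuous_on_compose2[OF cont_stereo[of UNIV]]) auto
  qed auto
  have "continuous (at z) \<psi>" for z
    using cont\<psi>_cball[of z 1] by (rule continuous_on_interior) simp
  then have cont\<psi>: "continuous_on A \<psi>" for A
    by (simp add: continuous_at_imp_continuous_on)
  have norm\<psi>: "norm (\<psi> z) = 1" for z by (simp add: \<psi>_def)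
  have snd1: "snd (\<psi> z) \<le> 1" for z
    using norm\<psi>[of z] norm_snd_le[of "snd (\<psi> z)" "fst (\<psi> z)"] by simp
  have fst0: "fst (\<psi> z) = 0 \<longleftrightarrow> snd (\<psi> z) = 1 \<or> snd (\<psi> z) = -1" for z
  proof -
    have "(cmod (fst (\<psi> z)))\<^sup>2 + (snd (\<psi> z))\<^sup>2 = 1"
      using norm\<psi>[of z] by (simp add: norm_prod_def)
    then show ?thesis by (auto simp: power2_eq_1_iff)
  qed
  define S where "S = {z. snd (\<psi> z) = 1}"
  define q where "q = (\<lambda>z. cnj (fst (\<psi> z)) / of_real (1 + snd (\<psi> z)))"
  \<comment> \<open>Near a pole of the limit the projected values of late \<open>h k\<close> have
    positive last coordinate, whereas a zero of \<open>h k\<close> would give -1. Discarding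
    \<open>N\<close> terms makes all reciprocals available, with limit \<open>q\<close> in the chart
    at infinity.\<close>
  have near_pole: "\<exists>r>0. \<exists>N. (\<forall>z\<in>cball z0 r. snd (\<psi> z) > 1 / 2) \<and>
      (\<forall>k\<ge>N. \<forall>z\<in>cball z0 r. h k z \<noteq> 0) \<and>
      uniform_limit (cball z0 r) (\<lambda>k z. 1 / h (k + N) z) q sequentially"
    if "z0 \<in> S" for z0
  proof -
    have "open ((\<lambda>z. snd (\<psi> z)) -` {1/2<..})"
      using cont\<psi> by (intro open_vimage) (auto intro!: continuous_intros)
    moreover have "z0 \<in> (\<lambda>z. snd (\<psi> z)) -` {1/2<..}" using that by (simp add: S_def)
    ultimately obtain r where "r > 0" "cball z0 r \<subseteq> (\<lambda>z. snd (\<psi> z)) -` {1/2<..}"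
      unfolding open_contains_cball by blast
    then have r: "r > 0" "\<And>z. z \<in> cball z0 r \<Longrightarrow> snd (\<psi> z) > 1 / 2" by auto
    have "\<forall>\<^sub>F k in sequentially. \<forall>z\<in>cball z0 r. dist (stereo (h k z)) (\<psi> z) < 1 / 2"
      by (rule uniform_limitD[OF ul[OF compact_cball]]) simp
    then obtain N where N: "\<And>k z. k \<ge> N \<Longrightarrow> z \<in> cball z0 r \<Longrightarrow> dist (stereo (h k z)) (\<psi> z) < 1 / 2"
      unfolding eventually_sequentially by blast
    have nz: "h k z \<noteq> 0" if "k \<ge> N" "z \<in> cball z0 r" for k z
    proof
      assume "h k z = 0"
      then have "snd (stereo (h k z)) = -1" by (simp add: stereo_def)
      moreover have "dist (snd (stereo (h k z))) (snd (\<psi> z)) < 1 / 2"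
        using N[OF that] dist_snd_le order_le_less_trans by blast
      ultimately show False using r(2)[OF that(2)] by (simp add: dist_norm)
    qed
    have fN: "filterlim (\<lambda>k. k + N) sequentially sequentially" by (rule filterlim_add_const_nat_at_top)
    have ulN: "uniform_limit (cball z0 r) (\<lambda>k z. stereo (h (k + N) z)) \<psi> sequentially"
      using filterlim_compose[OF ul[OF compact_cball] fN] .
    have "uniform_limit (cball z0 r) (\<lambda>k z. cnj (fst (stereo (h (k + N) z))) / of_real (1 + snd (stereo (h (k + N) z)))) q sequentially"
      unfolding q_def
    proof (rule uniform_lim_divide)
      have bl1: "bounded_linear (\<lambda>v::complex \<times> real. cnj (fst v))"
        by (rule bounded_linear_compose[OF bounded_linear_cnj bounded_linear_fst])
      have bl2: "bounded_linear (\<lambda>v::complex \<times> real. complex_of_real (snd v))"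
        by (rule bounded_linear_compose[OF bounded_linear_of_real bounded_linear_snd])
      show "uniform_limit (cball z0 r) (\<lambda>k z. cnj (fst (stereo (h (k + N) z)))) (\<lambda>z. cnj (fst (\<psi> z))) sequentially"
        by (rule bounded_linear.uniform_limit[OF bl1 ulN])
      have "uniform_limit (cball z0 r) (\<lambda>k z. 1 + complex_of_real (snd (stereo (h (k + N) z)))) (\<lambda>z. 1 + complex_of_real (snd (\<psi> z))) sequentially"
        by (intro uniform_limit_add uniform_limit_const bounded_linear.uniform_limit[OF bl2 ulN])
      then show "uniform_limit (cball z0 r) (\<lambda>k z. complex_of_real (1 + snd (stereo (h (k + N) z)))) (\<lambda>z. complex_of_real (1 + snd (\<psi> z))) sequentially"
        by simp
      have "cmod (fst (\<psi> z)) \<le> 1" for z using norm_fst_le[of "fst (\<psi> z)" "snd (\<psi> z)"] norm\<psi>[of z] by simp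
      then show "bounded ((\<lambda>z. cnj (fst (\<psi> z))) ` cball z0 r)" by (auto simp: bounded_iff)
      show "1 \<le> cmod (complex_of_real (1 + snd (\<psi> z)))" if "z \<in> cball z0 r" for z
        unfolding norm_of_real using r(2)[OF that] by simp
    qed simp
    then have "uniform_limit (cball z0 r) (\<lambda>k z. 1 / h (k + N) z) q sequentially"
      by (rule uniform_limit_cong'[THEN iffD1, rotated 2]) (use nz stereo_inverse(2) in auto)
    then show ?thesis using r nz by blast
  qed
  have q0: "q z = 0 \<longleftrightarrow> snd (\<psi> z) = 1" if "snd (\<psi> z) > 1 / 2" for z
    using that fst0[of z] by (auto simp: q_def simp del: of_real_add)
  have S_open: "open S"
    unfolding open_contains_ball
  proof
    fix z0 assume z0: "z0 \<in> S"
    obtain r N where r: "r > 0" "\<And>z. z \<in> cball z0 r \<Longrightarrow> snd (\<psi> z) > 1 / 2"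
      and nz: "\<And>k z. k \<ge> N \<Longrightarrow> z \<in> cball z0 r \<Longrightarrow> h k z \<noteq> 0"
      and ulq: "uniform_limit (cball z0 r) (\<lambda>k z. 1 / h (k + N) z) q sequentially"
      using near_pole[OF z0] by meson
    have holq: "(\<lambda>z. 1 / h (k + N) z) holomorphic_on A" if "A \<subseteq> cball z0 r" for A k
      using nz that by (intro holomorphic_intros holomorphic_on_subset[OF hol]) auto
    have "\<forall>\<^sub>F k in sequentially. continuous_on (cball z0 r) (\<lambda>z. 1 / h (k + N) z) \<and>
        (\<lambda>z. 1 / h (k + N) z) holomorphic_on ball z0 r"
      by (intro always_eventually allI conjI holomorphic_on_imp_continuous_on holq) auto
    then have "q holomorphic_on ball z0 r"
      using holomorphic_uniform_limit[OF _ ulq] by auto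
    moreover have "uniform_limit K (\<lambda>k z. 1 / h (k + N) z) q sequentially" if "K \<subseteq> ball z0 r" for K
      using ulq by (rule uniform_limit_on_subset) (use that in auto)
    moreover have "q z0 = 0" using q0[of z0] r z0 by (auto simp: S_def)
    ultimately have "q constant_on ball z0 r"
      using Hurwitz_no_zeros[of "ball z0 r" "\<lambda>k z. 1 / h (k + N) z" q z0] holq nz r(1) by (auto simp: ball_subset_cball)
    then have "q z = 0" if "z \<in> ball z0 r" for z
      using \<open>q z0 = 0\<close> that r(1) unfolding constant_on_def by (metis centre_in_ball)
    then have "ball z0 r \<subseteq> S" using q0 r(2) by (auto simp: S_def)
    then show "\<exists>e>0. ball z0 e \<subseteq> S" using r(1) by blast
  qed
  have S_closed: "closed S"
  proof -
    have "S = (\<lambda>z. snd (\<psi> z)) -` {1}" by (auto simp: S_def)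
    then show ?thesis using cont\<psi> by (auto intro!: closed_vimage continuous_intros)
  qed
  have deriv1: "1 \<le> cmod (deriv (h k) 0)" for k
  proof -
    have "cmod (deriv (h k) 0) = 1 + (cmod (h k 0))\<^sup>2"
      using d0[of k] by (simp add: sph_deriv_def divide_eq_1_iff)
    then show ?thesis by simp
  qed
  \<comment> \<open>Otherwise the reciprocals tend uniformly to 0 near 0, and the Cauchy estimate
    makes the derivative of some \<open>1 / f\<close>, with \<open>f = h (k + N)\<close>, at most
    1/2 at 0 in modulus. But spherical derivative 1 makes that modulus
    \<open>(1 + (cmod (f 0))\<^sup>2) / (cmod (f 0))\<^sup>2\<close>.\<close>
  have "S \<noteq> UNIV"
  proof
    assume S: "S = UNIV"
    then have "(0::complex) \<in> S" by simp
    from near_pole[OF this] obtain r N where r: "r > 0" "\<And>z. z \<in> cball 0 r \<Longrightarrow> snd (\<psi> z) > 1 / 2"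
      and nz: "\<And>k z. k \<ge> N \<Longrightarrow> z \<in> cball 0 r \<Longrightarrow> h k z \<noteq> 0"
      and ulq: "uniform_limit (cball 0 r) (\<lambda>k z. 1 / h (k + N) z) q sequentially"
      by meson
    have qz: "q z = 0" if "z \<in> cball 0 r" for z using q0[OF r(2)[OF that]] S by (auto simp: S_def)
    have "\<forall>\<^sub>F k in sequentially. \<forall>z\<in>cball 0 r. dist (1 / h (k + N) z) (q z) < r / 2"
      using r(1) by (intro uniform_limitD[OF ulq]) simp
    then obtain k where "\<forall>z\<in>cball 0 r. dist (1 / h (k + N) z) (q z) < r / 2"
      unfolding eventually_sequentially by blast
    with qz have k: "dist (1 / h (k + N) z) 0 < r / 2" if "z \<in> cball 0 r" for z using that by metis
    define f where "f = h (k + N)"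
    have nzf: "f z \<noteq> 0" if "z \<in> cball 0 r" for z using nz that by (auto simp: f_def)
    have holf: "(\<lambda>z. 1 / f z) holomorphic_on A" if "A \<subseteq> cball 0 r" for A
      unfolding f_def using nz that by (intro holomorphic_intros holomorphic_on_subset[OF hol]) auto
    have "dist (deriv (\<lambda>z. 1 / f z) 0) (deriv (\<lambda>_. 0) 0) \<le> (r / 2) / r"
      using k r(1) by (intro deriv_close holf holomorphic_on_imp_continuous_on) (auto simp: f_def intro!: continuous_intros)
    then have small: "cmod (deriv (\<lambda>z. 1 / f z) 0) \<le> 1 / 2" using r(1) by simp
    have "(f has_field_derivative deriv f 0) (at 0)"
      unfolding f_def using hol by (rule holomorphic_derivI) auto
    then have "((\<lambda>z. 1 / f z) has_field_derivative - deriv f 0 / (f 0)\<^sup>2) (at 0)"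
      using nzf[of 0] r(1) by (auto intro!: derivative_eq_intros simp: power2_eq_square)
    then have "cmod (deriv (\<lambda>z. 1 / f z) 0) = cmod (deriv f 0) / (cmod (f 0))\<^sup>2"
      by (simp add: DERIV_imp_deriv norm_divide norm_power)
    also have "cmod (deriv f 0) = 1 + (cmod (f 0))\<^sup>2"
      using d0[of "k + N"] by (simp add: sph_deriv_def f_def divide_eq_1_iff)
    also have "\<dots> / (cmod (f 0))\<^sup>2 \<ge> 1" using nzf[of 0] r(1) by (simp add: field_simps)
    finally show False using small by simp
  qed
  then have "S = {}" using S_open S_closed clopen[of S] by blast
  then have lt1: "snd (\<psi> z) < 1" for z using snd1[of z] by (auto simp: S_def order_less_le)
  define G where "G = (\<lambda>z. fst (\<psi> z) / of_real (1 - snd (\<psi> z)))"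
  have ulG: "uniform_limit K h G sequentially" if K: "compact K" for K
  proof (cases "K = {}")
    case False
    then obtain z1 where z1: "z1 \<in> K" "\<And>z. z \<in> K \<Longrightarrow> snd (\<psi> z) \<le> snd (\<psi> z1)"
      using continuous_attains_sup[OF K, of "\<lambda>z. snd (\<psi> z)"] cont\<psi> by (auto intro: continuous_intros)
    have "uniform_limit K (\<lambda>k z. fst (stereo (h k z)) / of_real (1 - snd (stereo (h k z)))) G sequentially"
      unfolding G_def
    proof (rule uniform_lim_divide)
      have bl2: "bounded_linear (\<lambda>v::complex \<times> real. complex_of_real (snd v))"
        by (rule bounded_linear_compose[OF bounded_linear_of_real bounded_linear_snd])
      show "uniform_limit K (\<lambda>k z. fst (stereo (h k z))) (\<lambda>z. fst (\<psi> z)) sequentially"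
        by (rule bounded_linear.uniform_limit[OF bounded_linear_fst ul[OF K]])
      have "uniform_limit K (\<lambda>k z. 1 - complex_of_real (snd (stereo (h k z)))) (\<lambda>z. 1 - complex_of_real (snd (\<psi> z))) sequentially"
        by (intro uniform_limit_minus uniform_limit_const bounded_linear.uniform_limit[OF bl2 ul[OF K]])
      then show "uniform_limit K (\<lambda>k z. complex_of_real (1 - snd (stereo (h k z)))) (\<lambda>z. complex_of_real (1 - snd (\<psi> z))) sequentially"
        by simp
      have "cmod (fst (\<psi> z)) \<le> 1" for z using norm_fst_le[of "fst (\<psi> z)" "snd (\<psi> z)"] norm\<psi>[of z] by simp
      then show "bounded ((\<lambda>z. fst (\<psi> z)) ` K)" by (auto simp: bounded_iff)
      show "1 - snd (\<psi> z1) \<le> cmod (complex_of_real (1 - snd (\<psi> z)))" if "z \<in> K" for z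
        unfolding norm_of_real using z1(2)[OF that] lt1[of z] by simp
    qed (use lt1 in simp)
    then show ?thesis by (simp only: stereo_inverse)
  qed auto
  have "\<exists>d>0. cball x d \<subseteq> UNIV \<and> uniform_limit (cball x d) h G sequentially" if "x \<in> UNIV" for x
    using ulG[of "cball x 1"] by (intro exI[of _ 1] conjI) simp_all
  from holomorphic_uniform_sequence[OF open_UNIV hol this] have holG: "G holomorphic_on UNIV" .
  \<comment> \<open>Spherical derivative 1 at 0 forces \<open>cmod (deriv (h k) 0)\<close> to be at
    least 1, and uniform closeness to a constant would make it at most 1/2.\<close>
  have "\<not> G constant_on UNIV"
  proof
    assume "G constant_on UNIV"
    then obtain b where "G = (\<lambda>_. b)" by (auto simp: constant_on_def)
    then have "deriv G 0 = 0" by simp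
    have "\<forall>\<^sub>F k in sequentially. \<forall>z\<in>cball 0 1. dist (h k z) (G z) < 1 / 2"
      by (rule uniform_limitD[OF ulG[OF compact_cball]]) simp
    then obtain k where k: "\<And>z. z \<in> cball 0 1 \<Longrightarrow> dist (h k z) (G z) < 1 / 2"
      unfolding eventually_sequentially by blast
    have "dist (deriv (h k) 0) (deriv G 0) \<le> (1 / 2) / 1"
      using k by (intro deriv_close holomorphic_on_imp_continuous_on)
        (auto intro: holomorphic_on_subset[OF hol] holomorphic_on_subset[OF holG])
    with deriv1[of k] \<open>deriv G 0 = 0\<close> show False by simp
  qed
  with holG ulG show ?thesis by blast
qed

section \<open>Rescaling at a point of non-normality\<close>

lemma strict_mono_selection:
  assumes "\<And>k N. \<exists>n\<ge>N. P k n"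
  shows "\<exists>s :: nat \<Rightarrow> nat. strict_mono s \<and> (\<forall>k. P k (s k))"
proof -
  have "\<exists>s. \<forall>n. P n (s n) \<and> s n < s (Suc n)"
    by (rule dependent_nat_choice) (use assms in \<open>auto simp: less_eq_Suc_le conj_commute\<close>)
  then show ?thesis by (auto simp: strict_mono_Suc_iff)
qed

lemma sph_deriv_rescale:
  assumes "g holomorphic_on UNIV" "r > 0"
  shows "sph_deriv (\<lambda>u. g (a + of_real r * u)) u = r * sph_deriv g (a + of_real r * u)"
proof -
  have "(g has_field_derivative deriv g (a + of_real r * u)) (at (a + of_real r * u))"
    using assms(1) by (rule holomorphic_derivI) auto
  then have "((\<lambda>u. g (a + of_real r * u)) has_field_derivative deriv g (a + of_real r * u) * of_real r) (at u)"
    by (rule DERIV_chain2) (auto intro!: derivative_eq_intros)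
  then show ?thesis using assms(2) by (simp add: sph_deriv_def DERIV_imp_deriv norm_mult)
qed

text \<open>The base point maximises the spherical derivative weighted by the distance to the
  boundary of a shrinking disc. Rescaling by the reciprocal of the derivative there normalises it to
  1 at 0 and keeps it at most 2 on growing discs, so Marty's criterion applies in the whole
  plane.\<close>

lemma zalcman_blowup:
  fixes g :: "nat \<Rightarrow> complex \<Rightarrow> complex"
  assumes hol: "\<And>k. g k holomorphic_on UNIV"
    and bad: "\<And>r M N. r > 0 \<Longrightarrow> \<exists>k\<ge>N. \<exists>z\<in>ball p r. M < sph_deriv (g k) z"
  shows "\<exists>s :: nat \<Rightarrow> nat. strict_mono s \<and> blowup (g \<circ> s) p"
proof -
  define R where "R = (\<lambda>k::nat. 1 / real (Suc k))"
  have Rpos: "R k > 0" for k by (simp add: R_def)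
  \<comment> \<open>The square beats the radius \<open>R k\<close>: the weighted maximum exceeds
    \<open>real (Suc k)\<close>, so the discs on which the rescaled functions are controlled exhaust
    the plane.\<close>
  obtain s1 :: "nat \<Rightarrow> nat" where s1: "strict_mono s1"
    "\<And>k. \<exists>z\<in>ball p (R k). (real (Suc k))\<^sup>2 < sph_deriv (g (s1 k)) z"
    using strict_mono_selection[of "\<lambda>k n. \<exists>z\<in>ball p (R k). (real (Suc k))\<^sup>2 < sph_deriv (g n) z"] bad Rpos
    by metis
  define f where "f = (\<lambda>k. g (s1 k))"
  have holf: "f k holomorphic_on UNIV" for k using hol by (simp add: f_def)
  have contsd: "continuous_on A (sph_deriv (f k))" for A k
  proof -
    have "continuous_on A (f k)" "continuous_on A (deriv (f k))"
      using holomorphic_on_subset[OF holf] holomorphic_on_subset[OF holomorphic_deriv[OF holf open_UNIV]]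
      by (auto intro!: holomorphic_on_imp_continuous_on)
    then show ?thesis unfolding sph_deriv_def by (intro continuous_intros) auto
  qed
  \<comment> \<open>Maximising \<open>W\<close>, which vanishes on the boundary, makes the rescaled spherical derivatives bounded.\<close>
  define W where "W = (\<lambda>k z. (2 * R k - dist p z) * sph_deriv (f k) z)"
  have "\<exists>\<zeta>\<in>cball p (2 * R k). \<forall>z\<in>cball p (2 * R k). W k z \<le> W k \<zeta>" for k
    unfolding W_def using Rpos[of k]
    by (intro continuous_attains_sup continuous_intros contsd) auto
  then obtain \<zeta> where \<zeta>: "\<And>k. \<zeta> k \<in> cball p (2 * R k)"
    and max: "\<And>k z. z \<in> cball p (2 * R k) \<Longrightarrow> W k z \<le> W k (\<zeta> k)" by metis
  have Wbig: "real (Suc k) < W k (\<zeta> k)" for k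
  proof -
    obtain z where z: "z \<in> ball p (R k)" "(real (Suc k))\<^sup>2 < sph_deriv (f k) z"
      using s1(2)[of k] by (auto simp: f_def)
    have "real (Suc k) = R k * (real (Suc k))\<^sup>2" by (simp add: R_def power2_eq_square)
    also have "\<dots> < R k * sph_deriv (f k) z" using z Rpos by (intro mult_strict_left_mono) auto
    also have "\<dots> \<le> W k z" unfolding W_def using z by (intro mult_right_mono) auto
    also have "\<dots> \<le> W k (\<zeta> k)" using z Rpos[of k] by (intro max) auto
    finally show ?thesis .
  qed
  have Wpos: "0 < W k (\<zeta> k)" for k using Wbig[of k] by (smt (verit) of_nat_0_le_iff)
  have sdpos: "0 < sph_deriv (f k) (\<zeta> k)" for k
    using Wpos[of k] sph_deriv_nonneg[of "f k" "\<zeta> k"] by (auto simp: W_def zero_less_mult_iff)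
  define \<rho> where "\<rho> = (\<lambda>k. 1 / sph_deriv (f k) (\<zeta> k))"
  have \<rho>pos: "\<rho> k > 0" for k using sdpos by (simp add: \<rho>_def)
  have W\<rho>: "W k (\<zeta> k) * \<rho> k = 2 * R k - dist p (\<zeta> k)" for k
    using sdpos[of k] by (simp add: W_def \<rho>_def)
  have R0: "R \<longlonglongrightarrow> 0" unfolding R_def by (rule LIMSEQ_inverse_real_of_nat[unfolded inverse_eq_divide])
  have \<zeta>lim: "\<zeta> \<longlonglongrightarrow> p"
  proof (rule metric_LIMSEQ_I)
    fix e :: real assume "e > 0"
    have "(\<lambda>k. 2 * R k) \<longlonglongrightarrow> 0" using tendsto_mult_left[OF R0, of 2] by simp
    from order_tendstoD(2)[OF this \<open>e > 0\<close>] obtain N where "\<And>k. k \<ge> N \<Longrightarrow> 2 * R k < e"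
      by (auto simp: eventually_sequentially)
    then show "\<exists>N. \<forall>k\<ge>N. dist (\<zeta> k) p < e"
      using \<zeta> by (auto simp: dist_commute intro: order_le_less_trans)
  qed
  have \<rho>lim: "\<rho> \<longlonglongrightarrow> 0"
  proof (rule tendsto_sandwich[OF _ _ tendsto_const])
    show "(\<lambda>k. 2 * R k) \<longlonglongrightarrow> 0" using tendsto_mult_left[OF R0, of 2] by simp
    have "\<rho> k \<le> 2 * R k" for k
    proof -
      have "1 \<le> W k (\<zeta> k)" using Wbig[of k] by simp
      then have "\<rho> k \<le> W k (\<zeta> k) * \<rho> k" using \<rho>pos[of k] by simp
      also have "\<dots> \<le> 2 * R k" unfolding W\<rho> by simp
      finally show ?thesis .
    qed
    then show "\<forall>\<^sub>F k in sequentially. \<rho> k \<le> 2 * R k" by simp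
  qed (use \<rho>pos in \<open>auto intro!: always_eventually less_imp_le\<close>)
  define h where "h = (\<lambda>k u. f k (\<zeta> k + of_real (\<rho> k) * u))"
  have holh: "h k holomorphic_on UNIV" for k
  proof -
    have "(f k \<circ> (\<lambda>u. \<zeta> k + of_real (\<rho> k) * u)) holomorphic_on UNIV"
      using holf by (intro holomorphic_on_compose_gen[of _ UNIV _ UNIV]) (auto intro!: holomorphic_intros)
    then show ?thesis by (simp add: h_def o_def)
  qed
  have sdh: "sph_deriv (h k) u = \<rho> k * sph_deriv (f k) (\<zeta> k + of_real (\<rho> k) * u)" for k u
    unfolding h_def using holf \<rho>pos by (rule sph_deriv_rescale)
  have sdh0: "sph_deriv (h k) 0 = 1" for k using sdpos[of k] by (simp add: sdh \<rho>_def)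
  \<comment> \<open>In this range of \<open>u\<close> the weight at the rescaled point is at least
    half the weight at \<open>\<zeta> k\<close>. Maximality of \<open>W\<close> then bounds the
    spherical derivative there by twice its value at \<open>\<zeta> k\<close>.\<close>
  have sdh2: "sph_deriv (h k) u \<le> 2" if u: "2 * cmod u \<le> real (Suc k)" for k u
  proof -
    define z where "z = \<zeta> k + of_real (\<rho> k) * u"
    define w where "w = W k (\<zeta> k)"
    have w: "2 * cmod u \<le> w" "w > 0" using u Wbig[of k] Wpos[of k] by (auto simp: w_def)
    have "dist p z \<le> dist p (\<zeta> k) + \<rho> k * cmod u"
      using dist_triangle[of p z "\<zeta> k"] \<rho>pos[of k] by (simp add: z_def dist_norm norm_mult)
    also have "\<dots> \<le> dist p (\<zeta> k) + \<rho> k * (w / 2)" using w \<rho>pos[of k] by (intro add_left_mono mult_left_mono) auto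
    also have "\<rho> k * (w / 2) = w * \<rho> k / 2" by simp
    finally have d: "w * \<rho> k / 2 \<le> 2 * R k - dist p z" using W\<rho>[of k] unfolding w_def by linarith
    then have "w * \<rho> k / 2 * sph_deriv (f k) z \<le> W k z"
      unfolding W_def by (rule mult_right_mono) simp
    also have "\<dots> \<le> w" unfolding w_def
    proof (rule max)
      have "0 \<le> w * \<rho> k / 2" using w \<rho>pos[of k] by simp
      then show "z \<in> cball p (2 * R k)" using d by simp
    qed
    finally have "w * (\<rho> k * sph_deriv (f k) z) \<le> w * 2" by simp
    then show ?thesis using w by (simp add: sdh z_def)
  qed
  have "\<exists>s2 \<phi>. strict_mono (s2 :: nat \<Rightarrow> nat) \<and> sph_locally_uniform (h \<circ> s2) \<phi> UNIV"
  proof (rule marty_convergent_subsequence[OF holh])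
    fix a :: complex
    obtain N where N: "2 * (cmod a + 1) \<le> real N" using real_arch_simple by blast
    have "sph_deriv (h k) z \<le> 2" if "k \<ge> N" "z \<in> ball a 1" for k z
    proof (rule sdh2)
      have "cmod z \<le> cmod a + 1"
        using that norm_triangle_ineq[of a "z - a"] by (simp add: dist_norm norm_minus_commute)
      moreover have "real N \<le> real k" using that by simp
      ultimately show "2 * cmod z \<le> real (Suc k)" using N by simp
    qed
    then show "\<exists>r>0. \<exists>M N. \<forall>k\<ge>N. \<forall>z\<in>ball a r. sph_deriv (h k) z \<le> M"
      by (intro exI[of _ 1] conjI exI[of _ 2] exI[of _ N]) auto
  qed
  then obtain s2 \<phi> where s2: "strict_mono (s2 :: nat \<Rightarrow> nat)" "sph_locally_uniform (h \<circ> s2) \<phi> UNIV" by blast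
  obtain G where G: "G holomorphic_on UNIV" "\<not> G constant_on UNIV"
    "\<And>K. compact K \<Longrightarrow> uniform_limit K (h \<circ> s2) G sequentially"
    using entire_limit_of_spherical_limit[OF _ s2(2)] holh sdh0 by auto
  have "blowup (g \<circ> (s1 \<circ> s2)) p"
    unfolding blowup_def
    using G \<rho>pos LIMSEQ_subseq_LIMSEQ[OF \<zeta>lim s2(1)] LIMSEQ_subseq_LIMSEQ[OF \<rho>lim s2(1)]
    by (intro exI[of _ "\<zeta> \<circ> s2"] exI[of _ "\<rho> \<circ> s2"] exI[of _ G]) (auto simp: h_def f_def o_def)
  then show ?thesis using s1(1) s2(1) strict_mono_o by blast
qed

section \<open>Islands near points of non-normality\<close>

lemma exists_blowup:
  fixes g :: "nat \<Rightarrow> complex \<Rightarrow> complex"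
  assumes hol: "\<And>k. g k holomorphic_on UNIV"
    and "\<And>s \<phi>. strict_mono s \<Longrightarrow> \<not> sph_locally_uniform (g \<circ> s) \<phi> \<Omega>"
  shows "\<exists>p\<in>\<Omega>. \<exists>s :: nat \<Rightarrow> nat. strict_mono s \<and> blowup (g \<circ> s) p"
proof -
  obtain p where p: "p \<in> \<Omega>" "\<not> (\<exists>r>0. \<exists>M N. \<forall>k\<ge>N. \<forall>z\<in>ball p r. sph_deriv (g k) z \<le> M)"
    using marty_convergent_subsequence[where g=g and \<Omega>=\<Omega>] assms by blast
  then have "\<exists>k\<ge>N. \<exists>z\<in>ball p r. M < sph_deriv (g k) z" if "r > 0" for r M N
    using that by (meson not_le)
  with zalcman_blowup[of g p] hol p(1) show ?thesis by blast
qed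

text \<open>The points already found serve as the finite set \<open>Q\<close> removed from the
  plane, which forces the next point to be new.\<close>

lemma many_blowups:
  fixes g :: "nat \<Rightarrow> complex \<Rightarrow> complex"
  assumes hol: "\<And>k. g k holomorphic_on UNIV"
    and nconv: "\<And>Q s \<phi>. finite Q \<Longrightarrow> strict_mono s \<Longrightarrow> \<not> sph_locally_uniform (g \<circ> s) \<phi> (UNIV - Q)"
  shows "\<exists>(s :: nat \<Rightarrow> nat) P. strict_mono s \<and> finite P \<and> card P = n \<and> (\<forall>p\<in>P. blowup (g \<circ> s) p)"
proof (induction n)
  case 0
  show ?case by (intro exI[of _ id] exI[of _ "{}"]) (auto simp: strict_mono_def)
next
  case (Suc n)
  then obtain s :: "nat \<Rightarrow> nat" and P where s: "strict_mono s" and P: "finite P" "card P = n"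
    "\<And>p. p \<in> P \<Longrightarrow> blowup (g \<circ> s) p" by blast
  obtain p and t :: "nat \<Rightarrow> nat" where p: "p \<notin> P" and t: "strict_mono t" "blowup ((g \<circ> s) \<circ> t) p"
    using exists_blowup[of "g \<circ> s" "UNIV - P"] hol nconv[OF P(1) strict_mono_o[OF s]]
    by (auto simp: o_assoc[symmetric])
  have "blowup (g \<circ> (s \<circ> t)) p'" if "p' \<in> insert p P" for p'
    using that t blowup_subseq[OF P(3) t(1)] by (auto simp: o_assoc)
  moreover have "finite (insert p P)" "card (insert p P) = Suc n" using p P(1,2) by auto
  ultimately show ?case using strict_mono_o[OF s t(1)] by blast
qed

text \<open>\<open>e\<close> is the value that Picard allows \<open>G\<close> to omit, independent
  of \<open>a\<close>. For other \<open>a\<close>, an isolated zero of \<open>G - a\<close> and the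
  minimum of its modulus on a small circle persist approximately for \<open>g k\<close>. The radius
  is fixed before \<open>k\<close>, so one radius can later serve finitely many targets.\<close>

lemma blowup_islands:
  assumes "blowup g p"
  shows "\<exists>e. \<forall>a. a \<noteq> e \<longrightarrow> (\<forall>\<^sub>F r in at_right 0. \<forall>\<^sub>F k in sequentially. island (g k) \<delta> p a r)"
proof -
  obtain \<zeta> \<rho> G where \<zeta>: "\<zeta> \<longlonglongrightarrow> p" and \<rho>: "\<rho> \<longlonglongrightarrow> 0" "\<And>k. 0 < \<rho> k"
    and G: "G holomorphic_on UNIV" "\<not> G constant_on UNIV"
    and ul: "\<And>K. compact K \<Longrightarrow> uniform_limit K (\<lambda>k u. g k (\<zeta> k + of_real (\<rho> k) * u)) G sequentially"
    using assms unfolding blowup_def by blast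
  have "\<exists>e. \<forall>a. a \<noteq> e \<longrightarrow> a \<in> range G"
  proof (cases "range G = UNIV")
    case False
    then obtain b where b: "b \<notin> range G" by blast
    have "a \<in> range G" if "a \<noteq> b" for a
    proof (rule ccontr)
      assume "a \<notin> range G"
      with b have "range G \<inter> {a, b} = {}" by blast
      from little_Picard[OF G(1) that this] obtain c where "G = (\<lambda>x. c)" .
      then show False using G(2) by (auto simp: constant_on_def)
    qed
    then show ?thesis by blast
  qed simp
  then obtain e where e: "\<And>a. a \<noteq> e \<Longrightarrow> a \<in> range G" by blast
  have "\<forall>\<^sub>F r in at_right 0. \<forall>\<^sub>F k in sequentially. island (g k) \<delta> p a r" if ae: "a \<noteq> e" for a
  proof -
    obtain u0 where u0: "G u0 = a" using e[OF ae] by auto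
    obtain w where w: "G w \<noteq> a" using G(2) by (auto simp: constant_on_def)
    have "(\<lambda>u. G u - a) holomorphic_on UNIV" by (intro holomorphic_intros G(1))
    then obtain R where R: "R > 0" "\<And>u. u \<in> ball u0 R - {u0} \<Longrightarrow> G u - a \<noteq> 0"
    proof (rule isolated_zeros[OF _ open_UNIV connected_UNIV])
      show "G u0 - a = 0" "G w - a \<noteq> 0" using u0 w by simp_all
    qed (auto intro: that)
    define \<tau> where "\<tau> = R / 2"
    have \<tau>: "\<tau> > 0" "\<tau> < R" using R by (auto simp: \<tau>_def)
    have contG: "continuous_on A G" for A
      using G(1) holomorphic_on_imp_continuous_on holomorphic_on_subset by blast
    have "sphere u0 \<tau> \<noteq> {}" using \<tau> by simp
    then obtain u1 where u1: "u1 \<in> sphere u0 \<tau>"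
      "\<And>u. u \<in> sphere u0 \<tau> \<Longrightarrow> cmod (G u1 - a) \<le> cmod (G u - a)"
      using continuous_attains_inf[OF compact_sphere _ continuous_on_norm[OF continuous_on_diff[OF contG continuous_on_const]]]
      by blast
    define m where "m = cmod (G u1 - a)"
    have m: "m > 0" using R(2)[of u1] u1(1) \<tau> by (auto simp: m_def)
    \<comment> \<open>In the minimum, \<open>m / 2\<close> controls the circle, where
      \<open>cmod (G u - a)\<close> is at least \<open>m\<close>, and \<open>r\<close> controls the
      centre, where \<open>G u0 = a\<close>. The condition \<open>small\<close> places the rescaled
      disc within \<open>r / 2\<close> of \<open>p\<close>.\<close>
    have isl: "island (g k) \<delta> p a r"
      if r: "r > 0" "(1 + 2 * cmod \<delta>) * r \<le> m / 2"
        and ulk: "\<And>u. u \<in> cball u0 \<tau> \<Longrightarrow> dist (g k (\<zeta> k + of_real (\<rho> k) * u)) (G u) < min (m / 2) r"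
        and small: "dist (\<zeta> k) p + \<rho> k * (cmod u0 + \<tau>) < r / 2" for k r
      unfolding island_def
    proof (intro exI conjI ballI)
      let ?c = "\<zeta> k + of_real (\<rho> k) * u0"
      show "0 < \<rho> k * \<tau>" using \<rho> \<tau> by simp
      show "cball ?c (\<rho> k * \<tau>) \<subseteq> ball p (r / 2)"
      proof
        fix z assume "z \<in> cball ?c (\<rho> k * \<tau>)"
        moreover have "dist p ?c \<le> dist (\<zeta> k) p + \<rho> k * cmod u0"
          using dist_triangle[of p ?c "\<zeta> k"] \<rho>(2)[of k] by (simp add: dist_norm norm_mult norm_minus_commute)
        ultimately show "z \<in> ball p (r / 2)"
          using dist_triangle[of p z ?c] small by (simp add: algebra_simps)
      qed
      show "(1 + 2 * cmod \<delta>) * r \<le> cmod (g k z - a)" if "z \<in> sphere ?c (\<rho> k * \<tau>)" for z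
      proof -
        define u where "u = (z - \<zeta> k) / of_real (\<rho> k)"
        have z: "z = \<zeta> k + of_real (\<rho> k) * u" using \<rho>(2)[of k] by (simp add: u_def)
        have "\<rho> k * dist u0 u = \<rho> k * \<tau>"
          using that \<rho>(2)[of k] unfolding z
          by (simp add: dist_norm norm_mult flip: right_diff_distrib)
        then have u: "u \<in> sphere u0 \<tau>" using \<rho>(2)[of k] by simp
        have "m \<le> cmod (G u - a)" using u1(2)[OF u] by (simp add: m_def)
        also have "\<dots> \<le> dist (g k z) (G u) + cmod (g k z - a)"
          using norm_triangle_ineq[of "G u - g k z" "g k z - a"] by (simp add: dist_norm norm_minus_commute)
        also have "dist (g k z) (G u) < m / 2" using ulk[of u] u unfolding z by auto
        finally show ?thesis using r(2) by simp
      qed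
      show "cmod (g k ?c - a) < r" using ulk[of u0] \<tau> u0 by (simp add: dist_norm)
    qed
    have ev: "\<forall>\<^sub>F k in sequentially. (\<forall>u\<in>cball u0 \<tau>. dist (g k (\<zeta> k + of_real (\<rho> k) * u)) (G u) < min (m / 2) r) \<and>
        dist (\<zeta> k) p + \<rho> k * (cmod u0 + \<tau>) < r / 2" if "r > 0" for r
    proof (intro eventually_conj)
      show "\<forall>\<^sub>F k in sequentially. \<forall>u\<in>cball u0 \<tau>. dist (g k (\<zeta> k + of_real (\<rho> k) * u)) (G u) < min (m / 2) r"
        using ul[OF compact_cball] m that by (intro uniform_limitD) auto
      have "(\<lambda>k. dist (\<zeta> k) p + \<rho> k * (cmod u0 + \<tau>)) \<longlonglongrightarrow> dist p p + 0 * (cmod u0 + \<tau>)"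
        by (intro tendsto_intros \<zeta> \<rho>)
      then show "\<forall>\<^sub>F k in sequentially. dist (\<zeta> k) p + \<rho> k * (cmod u0 + \<tau>) < r / 2"
        using that by (intro order_tendstoD) auto
    qed
    have *: "\<forall>\<^sub>F k in sequentially. island (g k) \<delta> p a r"
      if r: "r > 0" "(1 + 2 * cmod \<delta>) * r \<le> m / 2" for r
      using ev[OF r(1)] by (rule eventually_mono) (elim conjE, intro isl[OF r], blast+)
    have pos: "1 + 2 * cmod \<delta> > 0" by (intro add_pos_nonneg) auto
    show ?thesis
      unfolding eventually_at_right_field
      using * pos m by (intro exI[of _ "m / 2 / (1 + 2 * cmod \<delta>)"]) (auto simp: field_simps)
  qed
  then show ?thesis by blast
qed

text \<open>All inequalities in \<open>island\<close> are homogeneous under the dilation by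
  \<open>n\<close>, and targets of the form \<open>c j + \<delta> * c l\<close> scale along with the
  centres.\<close>

lemma island_rescale:
  fixes n :: nat
  assumes "n \<ge> 1" and isl: "island (\<lambda>z. f (of_nat n * z) / of_nat n) \<delta> c a r"
  shows "island f \<delta> (of_nat n * c) (of_nat n * a) (real n * r)"
proof -
  obtain p \<rho> where p: "0 < \<rho>" "cball p \<rho> \<subseteq> ball c (r / 2)"
    "\<And>z. z \<in> sphere p \<rho> \<Longrightarrow> (1 + 2 * cmod \<delta>) * r \<le> cmod (f (of_nat n * z) / of_nat n - a)"
    "cmod (f (of_nat n * p) / of_nat n - a) < r"
    using isl unfolding island_def by blast
  have n: "real n > 0" "(of_nat n :: complex) \<noteq> 0" using assms(1) by auto
  have scale: "cmod (f (of_nat n * z) - of_nat n * a) = real n * cmod (f (of_nat n * z) / of_nat n - a)" for z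
  proof -
    have "f (of_nat n * z) - of_nat n * a = of_nat n * (f (of_nat n * z) / of_nat n - a)"
      using n by (simp add: field_simps)
    then show ?thesis by (simp only: norm_mult norm_of_nat)
  qed
  have dist_scale: "dist (of_nat n * x) (of_nat n * y) = real n * dist x y" for x y :: complex
    by (simp add: dist_norm norm_mult flip: right_diff_distrib)
  have pre: "\<exists>w. z = of_nat n * w" for z :: complex using n by (intro exI[of _ "z / of_nat n"]) simp
  show ?thesis
    unfolding island_def
  proof (intro exI[of _ "of_nat n * p"] exI[of _ "real n * \<rho>"] conjI ballI subsetI)
    show "0 < real n * \<rho>" using n p by simp
    show "cmod (f (of_nat n * p) - of_nat n * a) < real n * r" using p(4) n by (simp add: scale)
    fix z :: complex
    obtain w where w: "z = of_nat n * w" using pre by blast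
    show "z \<in> ball (of_nat n * c) (real n * r / 2)" if "z \<in> cball (of_nat n * p) (real n * \<rho>)"
    proof -
      have "w \<in> cball p \<rho>" using that n by (simp add: w dist_scale)
      then have "dist c w < r / 2" using p(2) by auto
      then show ?thesis using n by (simp add: w dist_scale)
    qed
    show "(1 + 2 * cmod \<delta>) * (real n * r) \<le> cmod (f z - of_nat n * a)" if "z \<in> sphere (of_nat n * p) (real n * \<rho>)"
    proof -
      have "w \<in> sphere p \<rho>" using that n by (simp add: w dist_scale)
      from mult_left_mono[OF p(3)[OF this], of "real n"] show ?thesis
        using n by (simp add: w scale mult.left_commute)
    qed
  qed
qed

theorem mainTheorem10:
  fixes f :: "complex \<Rightarrow> complex" and \<delta> :: complex
  assumes "transcendental_entire f"
    and "\<delta> \<noteq> 0"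
    and "\<not> quasi_normal {(\<lambda>z. f (of_nat n * z) / of_nat n) | n. n \<ge> 1} UNIV"
  shows "htop (UNIV :: (complex \<times> complex) set) (henon f \<delta>) = \<infinity>"
proof -
  have holf: "f holomorphic_on UNIV" using assms(1) by (simp add: transcendental_entire_def)
  obtain g :: "nat \<Rightarrow> complex \<Rightarrow> complex" where g: "\<forall>k. g k \<in> {(\<lambda>z. f (of_nat n * z) / of_nat n) | n. n \<ge> 1}"
    and no_limit: "\<not> (\<exists>Q s \<phi>. finite Q \<and> Q \<subseteq> UNIV \<and> strict_mono s \<and> sph_locally_uniform (g \<circ> s) \<phi> (UNIV - Q))"
    using assms(3) unfolding quasi_normal_def by blast
  have nconv: "\<not> sph_locally_uniform (g \<circ> s) \<phi> (UNIV - Q)" if "finite Q" "strict_mono s" for Q s \<phi>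
    using no_limit that by blast
  have holg: "g k holomorphic_on UNIV" for k
  proof -
    obtain n :: nat where "g k = (\<lambda>z. f (of_nat n * z) / of_nat n)" "n \<ge> 1" using g by blast
    moreover have "(f \<circ> (\<lambda>z. of_nat n * z)) holomorphic_on UNIV"
      using holf by (intro holomorphic_on_compose_gen[of _ UNIV _ UNIV]) (auto intro: holomorphic_intros)
    ultimately show ?thesis by (auto simp: o_def intro!: holomorphic_intros)
  qed
  have ge: "ereal (ln (real q)) \<le> htop UNIV (henon f \<delta>)" if q: "q > 0" for q :: nat
  proof -
    \<comment> \<open>One point to spare, since the value exceptional at \<open>c i\<close> can
      forbid one successor.\<close>
    define N where "N = Suc q"
    obtain s :: "nat \<Rightarrow> nat" and P where s: "strict_mono s" and P: "finite P" "card P = N"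
      and blow: "\<And>p. p \<in> P \<Longrightarrow> blowup (g \<circ> s) p"
      using many_blowups[of g N, OF holg nconv] by blast
    obtain c where c: "bij_betw c {..<N} P"
      using ex_bij_betw_nat_finite[OF P(1)] P(2) by (auto simp: lessThan_atLeast0)
    have cP: "c i \<in> P" if "i < N" for i using c that by (auto simp: bij_betw_def)
    have c_neq: "c i \<noteq> c j" if "i < N" "j < N" "i \<noteq> j" for i j
      using c that by (auto simp: bij_betw_def inj_on_def)
    have "\<forall>i\<in>{..<N}. \<exists>e. \<forall>a. a \<noteq> e \<longrightarrow>
        (\<forall>\<^sub>F r in at_right 0. \<forall>\<^sub>F k in sequentially. island ((g \<circ> s) k) \<delta> (c i) a r)"
      by (intro ballI blowup_islands blow cP) simp
    from bchoice[OF this] obtain e where "\<forall>i\<in>{..<N}. \<forall>a. a \<noteq> e i \<longrightarrow>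
        (\<forall>\<^sub>F r in at_right 0. \<forall>\<^sub>F k in sequentially. island ((g \<circ> s) k) \<delta> (c i) a r)" ..
    then have e: "\<forall>\<^sub>F r in at_right 0. \<forall>\<^sub>F k in sequentially. island ((g \<circ> s) k) \<delta> (c i) a r"
      if "i < N" "a \<noteq> e i" for i a using that by blast
    \<comment> \<open>Finiteness of the set of admissible triples allows a common radius
      \<open>r\<close>, then a common index \<open>k\<close>, and hence a single
      \<open>n\<close>.\<close>
    define T where "T = {(l, i, j). l < N \<and> i < N \<and> j < N \<and> c j + \<delta> * c l \<noteq> e i}"
    have finT: "finite T"
      by (rule finite_subset[of _ "{..<N} \<times> {..<N} \<times> {..<N}"]) (auto simp: T_def)
    have "\<forall>\<^sub>F r in at_right 0. \<forall>t\<in>T. case t of (l, i, j) \<Rightarrow>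
        \<forall>\<^sub>F k in sequentially. island ((g \<circ> s) k) \<delta> (c i) (c j + \<delta> * c l) r"
      using e by (intro eventually_ball_finite[OF finT]) (auto simp: T_def)
    moreover have "\<forall>\<^sub>F r in at_right 0. \<forall>t\<in>{..<N} \<times> {..<N}. case t of (i, j) \<Rightarrow> i \<noteq> j \<longrightarrow> 3 * r < dist (c i) (c j)"
    proof (rule eventually_ball_finite, simp, safe)
      fix i j assume ij: "i < N" "j < N"
      show "\<forall>\<^sub>F r in at_right 0. i \<noteq> j \<longrightarrow> 3 * r < dist (c i) (c j)"
      proof (cases "i = j")
        case False
        then have "dist (c i) (c j) > 0" using c_neq ij by simp
        then show ?thesis
          unfolding eventually_at_right_field by (intro exI[of _ "dist (c i) (c j) / 3"]) auto
      qed simp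
    qed
    moreover have "\<forall>\<^sub>F r in at_right 0. r > (0::real)" by (rule eventually_at_right_less)
    ultimately have "\<forall>\<^sub>F r in at_right 0. r > 0 \<and>
        (\<forall>t\<in>T. case t of (l, i, j) \<Rightarrow> \<forall>\<^sub>F k in sequentially. island ((g \<circ> s) k) \<delta> (c i) (c j + \<delta> * c l) r) \<and>
        (\<forall>t\<in>{..<N} \<times> {..<N}. case t of (i, j) \<Rightarrow> i \<noteq> j \<longrightarrow> 3 * r < dist (c i) (c j))"
      by eventually_elim auto
    from eventually_happens'[OF trivial_limit_at_right_real this] obtain r where r: "r > 0"
      and isl: "\<forall>t\<in>T. case t of (l, i, j) \<Rightarrow> \<forall>\<^sub>F k in sequentially. island ((g \<circ> s) k) \<delta> (c i) (c j + \<delta> * c l) r"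
      and sep': "\<forall>t\<in>{..<N} \<times> {..<N}. case t of (i, j) \<Rightarrow> i \<noteq> j \<longrightarrow> 3 * r < dist (c i) (c j)"
      by blast
    have sep: "3 * r < dist (c i) (c j)" if "i < N" "j < N" "i \<noteq> j" for i j
      using sep' that by auto
    have "\<forall>\<^sub>F k in sequentially. \<forall>t\<in>T. case t of (l, i, j) \<Rightarrow> island ((g \<circ> s) k) \<delta> (c i) (c j + \<delta> * c l) r"
      using isl by (intro eventually_ball_finite[OF finT]) (auto split: prod.splits)
    from eventually_happens'[OF sequentially_bot this] obtain k where
      "\<forall>t\<in>T. case t of (l, i, j) \<Rightarrow> island ((g \<circ> s) k) \<delta> (c i) (c j + \<delta> * c l) r" ..
    then have k: "island (g (s k)) \<delta> (c i) (c j + \<delta> * c l) r" if "(l, i, j) \<in> T" for l i j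
      using that by auto
    obtain n :: nat where n: "g (s k) = (\<lambda>z. f (of_nat n * z) / of_nat n)" "n \<ge> 1" using g by blast
    show ?thesis
    proof (rule htop_henon_ge_ln[where c="\<lambda>i. of_nat n * c i" and r="real n * r" and N=N, OF holf])
      show "real n * r > 0" using n r by simp
      show "q > 0" by (rule q)
      show "N > 0" by (simp add: N_def)
      show "3 * (real n * r) < dist (of_nat n * c i) (of_nat n * c j)" if "i < N" "j < N" "i \<noteq> j" for i j
        using sep[OF that] n by (simp add: dist_norm norm_mult flip: right_diff_distrib)
      fix l i assume li: "l < N" "i < N"
      define B where "B = {j. j < N \<and> c j + \<delta> * c l \<noteq> e i}"
      \<comment> \<open>A forbidden \<open>j\<close> satisfies
        \<open>c j = e i - \<delta> * c l\<close>, and the centres are distinct.\<close>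
      have "card ({..<N} - B) \<le> 1"
      proof (rule ccontr)
        assume "\<not> ?thesis"
        then obtain j j' where "j \<in> {..<N} - B" "j' \<in> {..<N} - B" "j \<noteq> j'"
          by (metis One_nat_def card_le_Suc0_iff_eq finite_Diff finite_lessThan)
        then have "c j = c j'" "j < N" "j' < N"
          by (auto simp: B_def) (metis add_right_cancel)
        with c_neq \<open>j \<noteq> j'\<close> show False by blast
      qed
      moreover have "card ({..<N} - B) = N - card B"
        by (subst card_Diff_subset) (auto simp: B_def)
      ultimately have "q \<le> card B" by (simp add: N_def)
      then obtain B' where B': "B' \<subseteq> B" "card B' = q"
        using obtain_subset_with_card_n by metis
      have "island f \<delta> (of_nat n * c i) (of_nat n * c j + \<delta> * (of_nat n * c l)) (real n * r)" if "j \<in> B'" for j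
      proof -
        have "(l, i, j) \<in> T" using that B' li by (auto simp: T_def B_def)
        from island_rescale[OF n(2) k[OF this, unfolded n(1)]] show ?thesis
          by (simp add: algebra_simps)
      qed
      then show "\<exists>B\<subseteq>{..<N}. card B = q \<and>
          (\<forall>j\<in>B. island f \<delta> (of_nat n * c i) (of_nat n * c j + \<delta> * (of_nat n * c l)) (real n * r))"
        using B' by (intro exI[of _ B']) (auto simp: B_def)
    qed
  qed
  show ?thesis
  proof (rule ereal_top)
    fix b :: real
    obtain q :: nat where q: "exp b \<le> real q" using real_arch_simple by blast
    then have q0: "real q > 0" using exp_gt_zero[of b] by linarith
    then have "b \<le> ln (real q)" using q by (simp add: ln_ge_iff)
    then show "ereal b \<le> htop UNIV (henon f \<delta>)"
      using ge[of q] q0 by (meson ereal_less_eq(3) of_nat_0_less_iff order_trans)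
  qed
qed

end
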